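(* Let $F$ be a Boolean formula of size $s$ computing a Boolean function $g:\{0,1\}^k\to\{0,1\}$, built from gates $\wedge,\vee,\oplus$ of arbitrary fan-in. Let $f_1,\dots,f_k$ be functions $f_i:\{0,1\}^n\times\{0,1\}^n\to\{0,1\}$ (each evaluated on parts of Alice's and Bob's inputs) with $GH(f_i)\le c$ for all $i$. Then for every constant $\epsilon>0$, $GH(g(f_1,\dots,f_k))\le O(s^{1+\epsilon}\cdot c)$ (the constant in the $O$ depending only on $\epsilon$).
   Context: A Boolean formula is a Boolean circuit in which every gate has fan-out 1 (a tree); its size is its number of leaves. Garden-hose model: Alice holds $x$, Bob holds $y$. A garden-hose protocol of size $s$ consists of a set $V$ of $s$ vertices (pipes) and an extra vertex $t$ (the tap), together with an assignment of a matching $E_A(x)$ on $V\cup\{t\}$ to every input $x$ of Alice and a matching $E_B(y)$ on $V$ to every input $y$ of Bob. In the graph $(V\cup\{t\},E_A(x)\cup E_B(y))$ every vertex has degree at most 2, so there is a unique maximal path starting at $t$; the output on $(x,y)$ is the parity of the number of edges of this path. The protocol computes a function if the output equals the function value for all inputs. $GH(h)$ is the minimum size of a garden-hose protocol computing $h$. *)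

theory Defs
  imports Complex_Main "HOL-Library.Countable"
begin

section \<open>Boolean formulas\<close>

datatype (vars: 'v) formula =
    Var 'v
  | And "'v formula list"
  | Or "'v formula list"
  | Xor "'v formula list"

fun eval :: "('v \<Rightarrow> bool) \<Rightarrow> 'v formula \<Rightarrow> bool" where
  "eval z (Var i) = z i"
| "eval z (And Fs) = (\<forall>F\<in>set Fs. eval z F)"
| "eval z (Or Fs) = (\<exists>F\<in>set Fs. eval z F)"
| "eval z (Xor Fs) = odd (length (filter (eval z) Fs))"

fun leaves :: "'v formula \<Rightarrow> nat" where
  "leaves (Var i) = 1"
| "leaves (And Fs) = sum_list (map leaves Fs)"
| "leaves (Or Fs) = sum_list (map leaves Fs)"
| "leaves (Xor Fs) = sum_list (map leaves Fs)"

text \<open>Every gate has at least one input, so the leaves of the tree are exactly its variable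
  occurrences; a gate of fan-in 0 would be a constant of size 0.\<close>

fun fan_in_pos :: "'v formula \<Rightarrow> bool" where
  "fan_in_pos (Var i) = True"
| "fan_in_pos (And Fs) = (Fs \<noteq> [] \<and> (\<forall>F\<in>set Fs. fan_in_pos F))"
| "fan_in_pos (Or Fs) = (Fs \<noteq> [] \<and> (\<forall>F\<in>set Fs. fan_in_pos F))"
| "fan_in_pos (Xor Fs) = (Fs \<noteq> [] \<and> (\<forall>F\<in>set Fs. fan_in_pos F))"

text \<open>An element of $\{0,1\}^k$ is a list of length \<open>k\<close>, with positions counted from 0.\<close>

definition formula_computes :: "nat \<Rightarrow> nat formula \<Rightarrow> (bool list \<Rightarrow> bool) \<Rightarrow> bool" where
  "formula_computes k F g \<longleftrightarrow>
     fan_in_pos F \<and> vars F \<subseteq> {..<k} \<and> (\<forall>z. length z = k \<longrightarrow> eval ((!) z) F = g z)"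


section \<open>The garden-hose model\<close>

definition matching :: "'a set \<Rightarrow> 'a set set \<Rightarrow> bool" where
  "matching W M \<longleftrightarrow> (\<forall>e\<in>M. e \<subseteq> W \<and> card e = 2) \<and> pairwise disjnt M"

definition path_from :: "'a \<Rightarrow> 'a set set \<Rightarrow> 'a list \<Rightarrow> bool" where
  "path_from t E p \<longleftrightarrow>
     p \<noteq> [] \<and> hd p = t \<and> distinct p \<and> successively (\<lambda>u v. {u, v} \<in> E) p"

definition max_path_from :: "'a \<Rightarrow> 'a set set \<Rightarrow> 'a list \<Rightarrow> bool" where
  "max_path_from t E p \<longleftrightarrow> path_from t E p \<and> (\<nexists>v. path_from t E (p @ [v]))"

text \<open>Only the number of pipes matters, so vertices are taken to be natural numbers.\<close>

record gh_protocol =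
  pipes :: "nat set"
  tap :: nat
  alice :: "bool list \<Rightarrow> nat set set"
  bob :: "bool list \<Rightarrow> nat set set"

definition gh_valid :: "nat \<Rightarrow> gh_protocol \<Rightarrow> bool" where
  "gh_valid n P \<longleftrightarrow> finite (pipes P) \<and> tap P \<notin> pipes P \<and>
     (\<forall>x. length x = n \<longrightarrow> matching (insert (tap P) (pipes P)) (alice P x)) \<and>
     (\<forall>y. length y = n \<longrightarrow> matching (pipes P) (bob P y))"

definition gh_path :: "gh_protocol \<Rightarrow> bool list \<Rightarrow> bool list \<Rightarrow> nat list" where
  "gh_path P x y = (THE p. max_path_from (tap P) (alice P x \<union> bob P y) p)"

text \<open>A path with vertex list \<open>p\<close> has \<open>length p - 1\<close> edges.\<close>

definition gh_output :: "gh_protocol \<Rightarrow> bool list \<Rightarrow> bool list \<Rightarrow> bool" where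
  "gh_output P x y \<longleftrightarrow> odd (length (gh_path P x y) - 1)"

definition gh_computes :: "nat \<Rightarrow> gh_protocol \<Rightarrow> (bool list \<Rightarrow> bool list \<Rightarrow> bool) \<Rightarrow> bool" where
  "gh_computes n P h \<longleftrightarrow> gh_valid n P \<and>
     (\<forall>x y. length x = n \<longrightarrow> length y = n \<longrightarrow> gh_output P x y = h x y)"

definition GH :: "nat \<Rightarrow> (bool list \<Rightarrow> bool list \<Rightarrow> bool) \<Rightarrow> nat" where
  "GH n h = (LEAST s. \<exists>P. gh_computes n P h \<and> card (pipes P) = s)"


section \<open>Well-definedness of the output and of \<open>GH\<close>\<close>

lemma matching_unique:
  assumes "matching W M" "{u, a} \<in> M" "{u, b} \<in> M"
  shows "a = b"
proof -
  have "\<not> disjnt {u, a} {u, b}" by (simp add: disjnt_def)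
  then have "{u, a} = {u, b}"
    using assms unfolding matching_def pairwise_def by metis
  then show ?thesis by (auto simp: doubleton_eq_iff)
qed

lemma path_from_nth:
  assumes "path_from t E p" "Suc i < length p"
  shows "{p ! i, p ! Suc i} \<in> E"
  using assms by (simp add: path_from_def successively_conv_nth)

lemma path_from_agree:
  assumes A: "matching (insert t V) A" and B: "matching V B" and t: "t \<notin> V"
    and p: "path_from t (A \<union> B) p" and q: "path_from t (A \<union> B) q"
    and "i < length p" "i < length q"
  shows "p ! i = q ! i"
  using assms(6,7)
proof (induction i rule: less_induct)
  case (less i)
  show ?case
  proof (cases i)
    case 0
    then show ?thesis using p q by (auto simp: path_from_def hd_conv_nth)
  next
    case (Suc j)
    let ?u = "p ! j"
    have u: "q ! j = ?u" using less Suc by simp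
    have e: "{?u, p ! i} \<in> A \<union> B" "{?u, q ! i} \<in> A \<union> B"
      using path_from_nth[OF p, of j] path_from_nth[OF q, of j] less.prems Suc u by auto
    show ?thesis
    proof (cases j)
      case 0
      then have "?u = t" using p by (auto simp: path_from_def hd_conv_nth)
      then have "{?u, p ! i} \<in> A" "{?u, q ! i} \<in> A"
        using e B t by (auto simp: matching_def)
      then show ?thesis by (rule matching_unique[OF A])
    next
      case (Suc l)
      let ?w = "p ! l"
      have w: "q ! l = ?w" using less \<open>i = Suc j\<close> Suc by simp
      have "{?u, ?w} \<in> A \<union> B"
        using path_from_nth[OF p, of l] less.prems \<open>i = Suc j\<close> Suc by (simp add: insert_commute)
      moreover have "p ! i \<noteq> ?w"
        using p less.prems \<open>i = Suc j\<close> Suc by (auto simp: path_from_def nth_eq_iff_index_eq)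
      moreover have "q ! i \<noteq> ?w"
        using q less.prems \<open>i = Suc j\<close> Suc
        unfolding w[symmetric] by (auto simp: path_from_def nth_eq_iff_index_eq)
      ultimately show ?thesis
        using e matching_unique[OF A] matching_unique[OF B] by (metis UnE)
    qed
  qed
qed

lemma max_path_from_ex1:
  assumes A: "matching (insert t V) A" and B: "matching V B" and t: "t \<notin> V" and fin: "finite V"
  shows "\<exists>!p. max_path_from t (A \<union> B) p"
proof -
  let ?E = "A \<union> B"
  have sub: "set p \<subseteq> insert t V" if p: "path_from t ?E p" for p
  proof
    fix v assume "v \<in> set p"
    then obtain i where i: "i < length p" "p ! i = v" by (auto simp: in_set_conv_nth)
    show "v \<in> insert t V"
    proof (cases i)
      case 0
      then show ?thesis using p i by (auto simp: path_from_def hd_conv_nth)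
    next
      case (Suc j)
      then have "{p ! j, v} \<in> ?E" using path_from_nth[OF p, of j] i by simp
      then show ?thesis using A B by (auto simp: matching_def)
    qed
  qed
  have bounded: "length p \<le> card (insert t V)" if "path_from t ?E p" for p
  proof -
    have "distinct p" using that by (simp add: path_from_def)
    then show ?thesis
      using sub[OF that] fin by (metis card_mono distinct_card finite_insert)
  qed
  have "path_from t ?E [t]" by (simp add: path_from_def)
  then have "\<exists>p. path_from t ?E p \<and> (\<forall>q. path_from t ?E q \<longrightarrow> length q \<le> length p)"
    by (rule ex_has_greatest_nat[where b = "Suc (card (insert t V))"])
      (use bounded in \<open>simp add: less_Suc_eq_le\<close>)
  then obtain p where p: "path_from t ?E p"
    and longest: "\<And>q. path_from t ?E q \<Longrightarrow> length q \<le> length p"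
    by blast
  have max_p: "max_path_from t ?E p"
    unfolding max_path_from_def
  proof (intro conjI notI p)
    assume "\<exists>v. path_from t ?E (p @ [v])"
    then show False using longest by fastforce
  qed
  have le: "length r \<le> length q" if q: "max_path_from t ?E q" and r: "path_from t ?E r" for q r
  proof (rule ccontr)
    assume "\<not> length r \<le> length q"
    then have lt: "length q < length r" by simp
    have q': "path_from t ?E q" using q by (simp add: max_path_from_def)
    have "take (length q) r = q"
      using lt path_from_agree[OF A B t q' r] by (intro nth_equalityI) auto
    then have eq: "take (Suc (length q)) r = q @ [r ! length q]"
      using lt by (simp add: take_Suc_conv_app_nth)
    have "path_from t ?E (take (Suc (length q)) r)"
      using r lt by (auto simp: path_from_def successively_conv_nth hd_conv_nth)
    then show False using q eq by (auto simp: max_path_from_def)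
  qed
  show ?thesis
  proof (intro ex1I[of _ p] max_p)
    fix q assume q: "max_path_from t ?E q"
    then have q': "path_from t ?E q" by (simp add: max_path_from_def)
    have "length q = length p" using le[OF q p] le[OF max_p q'] by simp
    then show "q = p" using path_from_agree[OF A B t q' p] by (intro nth_equalityI) auto
  qed
qed

lemma gh_path_max:
  assumes "gh_valid n P" "length x = n" "length y = n"
  shows "max_path_from (tap P) (alice P x \<union> bob P y) (gh_path P x y)"
proof -
  have "\<exists>!p. max_path_from (tap P) (alice P x \<union> bob P y) p"
    by (rule max_path_from_ex1[of _ "pipes P"]) (use assms in \<open>auto simp: gh_valid_def\<close>)
  then show ?thesis unfolding gh_path_def by (rule theI')
qed

lemma gh_path_eqI:
  assumes "gh_valid n P" "length x = n" "length y = n"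
    and "max_path_from (tap P) (alice P x \<union> bob P y) p"
  shows "gh_path P x y = p"
proof -
  have "\<exists>!p. max_path_from (tap P) (alice P x \<union> bob P y) p"
    by (rule max_path_from_ex1[of _ "pipes P"]) (use assms in \<open>auto simp: gh_valid_def\<close>)
  then show ?thesis
    using gh_path_max[OF assms(1-3)] assms(4) by metis
qed

lemma gh_computes_exists: "\<exists>P. gh_computes n P h"
proof -
  define a where "a x = Suc (2 * to_nat x)" for x :: "bool list"
  define b where "b x = Suc (Suc (2 * to_nat x))" for x :: "bool list"
  define X where "X = {x :: bool list. length x = n}"
  define P where "P = \<lparr>pipes = a ` X \<union> b ` X, tap = 0, alice = (\<lambda>x. {{0, a x}}),
    bob = (\<lambda>y. {{a x, b x} | x. x \<in> X \<and> \<not> h x y})\<rparr>"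
  have inj: "a x = a x' \<longleftrightarrow> x = x'" "b x = b x' \<longleftrightarrow> x = x'" for x x'
    by (auto simp: a_def b_def)
  have ne: "a x \<noteq> b x'" "b x' \<noteq> a x" "a x \<noteq> 0" "b x \<noteq> 0" "0 \<noteq> a x" "0 \<noteq> b x" for x x'
    unfolding a_def b_def by presburger+
  have "finite X" using finite_lists_length_eq[of "UNIV :: bool set" n] by (simp add: X_def)
  then have valid: "gh_valid n P"
    unfolding gh_valid_def P_def matching_def pairwise_def disjnt_def
    by (auto simp: ne inj X_def)
  have "gh_output P x y = h x y" if l: "length x = n" "length y = n" for x y
  proof -
    have X: "x \<in> X" using l by (simp add: X_def)
    define E where "E = alice P x \<union> bob P y"
    have E: "{u, v} \<in> E \<longleftrightarrow> u = 0 \<and> v = a x \<or> u = a x \<and> v = 0 \<or>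
        (\<exists>x'. x' \<in> X \<and> \<not> h x' y \<and> (u = a x' \<and> v = b x' \<or> u = b x' \<and> v = a x'))" for u v
      by (simp add: E_def P_def doubleton_eq_iff) metis
    let ?p = "if h x y then [0, a x] else [0, a x, b x]"
    have "max_path_from 0 E ?p"
    proof (cases "h x y")
      case True
      then show ?thesis
        unfolding max_path_from_def path_from_def by (auto simp: E ne inj)
    next
      case False
      then show ?thesis
        using X unfolding max_path_from_def path_from_def by (auto simp: E ne inj)
    qed
    then have "gh_path P x y = ?p"
      using gh_path_eqI[OF valid l] by (simp add: E_def P_def)
    then show ?thesis by (simp add: gh_output_def)
  qed
  then show ?thesis using valid by (auto simp: gh_computes_def)
qed

lemma GH_attained: "\<exists>P. gh_computes n P h \<and> card (pipes P) = GH n h"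
proof -
  obtain P where "gh_computes n P h" using gh_computes_exists by blast
  then have "\<exists>P'. gh_computes n P' h \<and> card (pipes P') = card (pipes P)" by blast
  then show ?thesis
    unfolding GH_def
    by (rule LeastI[where P = "\<lambda>s. \<exists>P. gh_computes n P h \<and> card (pipes P) = s"])
qed

end

theory Submission
  imports Defs "HOL-Library.Z2" "HOL-Library.Function_Algebras"
begin

text \<open>A program that applies to a state from a finite set \<open>Q\<close> a sequence of permutations, each
  selected by one input bit, yields a garden-hose protocol with \<open>O(|Q|)\<close> copies of the protocols
  for \<open>f\<^sub>i\<close> per permutation. So it is enough to evaluate a formula of size \<open>s\<close> by such a program
  of length \<open>O(s powr (1 + \<epsilon>))\<close> whose state set depends only on \<open>\<epsilon>\<close>.

  The states are the contents of \<open>W\<close> registers over GF(2), and evaluating \<open>f\<close> means adding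
  \<open>f\<close> times register \<open>i\<close> to register \<open>j\<close>, whatever all registers contain (Ben-Or and Cleve). The naive
  recursion for a product is a commutator, which evaluates every factor twice and hence is quadratic
  for balanced formulas. A formula with \<open>q\<close> leaves is instead read as a series-parallel graph with
  \<open>q\<close> labelled edges and at most \<open>q + 1\<close> nodes, one register each: running over all edges once adds the
  formula, plus unwanted contributions of inner nodes, and conjugations and a single commutator
  clean these up with only 4 evaluations of every leaf, independently of \<open>q\<close>.

  Finally, a formula of size \<open>s\<close> is a formula with at most \<open>7 B\<close> leaves over formulas of size at
  most \<open>s / B\<close> with total size at most \<open>2 s\<close>. Every level of this recursion costs a factor 8, and there are
  \<open>log\<^sub>B s\<close> levels, so the length is about \<open>s\<close> times \<open>s powr (log B 8)\<close>.\<close>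

declare add_bit_eq_xor [simp del] mult_bit_eq_and [simp del]

section \<open>Permutation programs\<close>

text \<open>The number bounds the queries from above: a \<open>fixed\<close> permutation makes none
  and may carry any number, which permits padding. Permutations are bijections of the whole type
  that map \<open>Q\<close> onto itself, so that \<open>inv\<close> and composition stay those of
  total functions.\<close>

inductive perm_prog :: "'i set \<Rightarrow> 'q set \<Rightarrow> (('i \<Rightarrow> bool) \<Rightarrow> 'q \<Rightarrow> 'q) \<Rightarrow> nat \<Rightarrow> bool"
  for V :: "'i set" and Q :: "'q set"
where
  fixed: "bij \<sigma> \<Longrightarrow> \<sigma> ` Q = Q \<Longrightarrow> perm_prog V Q (\<lambda>_. \<sigma>) n"
| query: "i \<in> V \<Longrightarrow> bij \<sigma> \<Longrightarrow> \<sigma> ` Q = Q \<Longrightarrow> perm_prog V Q (\<lambda>z. if z i then \<sigma> else id) 1"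
| comp: "perm_prog V Q A a \<Longrightarrow> perm_prog V Q B b \<Longrightarrow> perm_prog V Q (\<lambda>z. A z \<circ> B z) (a + b)"

lemma perm_prog_mono: 
  assumes "perm_prog V Q A a" "a \<le> b"
  shows "perm_prog V Q A b"
proof -
  have "perm_prog V Q (\<lambda>z. id \<circ> A z) ((b - a) + a)"
    by (intro perm_prog.comp assms perm_prog.fixed) auto
  then show ?thesis using assms(2) by simp
qed

lemma perm_prog_bij: "perm_prog V Q A a \<Longrightarrow> bij (A z)"
  by (induction rule: perm_prog.induct) (simp_all add: bij_comp del: o_apply)

lemma inv_image_eq: "bij \<sigma> \<Longrightarrow> \<sigma> ` Q = Q \<Longrightarrow> inv \<sigma> ` Q = Q"
  by (metis bij_is_inj image_inv_f_f)

lemma perm_prog_inv: "perm_prog V Q A a \<Longrightarrow> perm_prog V Q (\<lambda>z. inv (A z)) a"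
proof (induction rule: perm_prog.induct)
  case (fixed \<sigma> n)
  then show ?case by (intro perm_prog.fixed bij_imp_bij_inv inv_image_eq)
next
  case (query i \<sigma>)
  have "(\<lambda>z::'a \<Rightarrow> bool. inv (if z i then \<sigma> else id)) = (\<lambda>z. if z i then inv \<sigma> else id)"
    by (auto simp: fun_eq_iff)
  with query show ?case
    by (simp only:) (intro perm_prog.query bij_imp_bij_inv inv_image_eq)
next
  case (comp A a B b)
  have "inv (A z \<circ> B z) = inv (B z) \<circ> inv (A z)" for z
    using comp perm_prog_bij by (intro o_inv_distrib) 
  then show ?case
    using perm_prog.comp[OF comp.IH(2,1)] by (simp only: add.commute)
qed


section \<open>Linear maps on registers\<close>

definition unit_vec :: "nat \<Rightarrow> nat \<Rightarrow> bit" where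
  "unit_vec s = (\<lambda>v. of_bool (v = s))"

definition add_to :: "nat \<Rightarrow> nat \<Rightarrow> bit \<Rightarrow> (nat \<Rightarrow> bit) \<Rightarrow> nat \<Rightarrow> bit" where
  "add_to s t c r = r(t := r t + c * r s)"

text \<open>Over GF(2) additivity is already linearity.\<close>

definition additive_map :: "((nat \<Rightarrow> bit) \<Rightarrow> 'a::plus) \<Rightarrow> bool" where
  "additive_map U \<longleftrightarrow> (\<forall>r r'. U (r + r') = U r + U r')"

text \<open>Think of an acyclic graph with source \<open>s\<close>, sink \<open>t\<close> and inner nodes \<open>N\<close>, with edges labelled
  in GF(2), and let \<open>c\<close> be the sum over all \<open>s\<close>-\<open>t\<close>-paths of the products of the labels.
  The predicate \<open>flow\<close> describes the map that adds along each edge its label times the tail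
  register to its head register; in \<open>flow_from\<close> only the source, and in
  \<open>flow_into\<close> only the sink, keeps its off-diagonal matrix entries.\<close>

definition flow :: "nat \<Rightarrow> nat \<Rightarrow> nat set \<Rightarrow> bit \<Rightarrow> ((nat \<Rightarrow> bit) \<Rightarrow> nat \<Rightarrow> bit) \<Rightarrow> bool" where
  "flow s t N c U \<longleftrightarrow> additive_map U \<and> (\<forall>r v. v \<notin> insert t N \<longrightarrow> U r v = r v) \<and>
     (\<forall>r. (\<forall>v\<in>insert s N. r v = 0) \<longrightarrow> U r = r) \<and> U (unit_vec s) t = c"

definition flow_from :: "nat \<Rightarrow> nat \<Rightarrow> nat set \<Rightarrow> bit \<Rightarrow> ((nat \<Rightarrow> bit) \<Rightarrow> nat \<Rightarrow> bit) \<Rightarrow> bool" where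
  "flow_from s t N c U \<longleftrightarrow> (\<exists>u. (\<forall>v. v \<notin> insert t N \<longrightarrow> u v = 0) \<and> u t = c \<and>
     U = (\<lambda>r. if r s = 1 then r + u else r))"

definition flow_into :: "nat \<Rightarrow> nat \<Rightarrow> nat set \<Rightarrow> bit \<Rightarrow> ((nat \<Rightarrow> bit) \<Rightarrow> nat \<Rightarrow> bit) \<Rightarrow> bool" where
  "flow_into s t N c U \<longleftrightarrow> (\<exists>\<phi>. additive_map \<phi> \<and> (\<forall>r. (\<forall>v\<in>insert s N. r v = 0) \<longrightarrow> \<phi> r = 0) \<and>
     \<phi> (unit_vec s) = c \<and> U = (\<lambda>r. r(t := r t + \<phi> r)))"

lemma bit_add_self [simp]: "(c :: bit) + c = 0" "c + (c + d) = d"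
  by (cases c; cases d; simp)+

lemma vec_add_self [simp]: "(r :: nat \<Rightarrow> bit) + r = 0" "r + (r + r') = r'"
  by (simp_all add: fun_eq_iff)

lemma flow_add_to: "s \<noteq> t \<Longrightarrow> flow s t N c (add_to s t c)"
  by (auto simp: flow_def add_to_def additive_map_def unit_vec_def algebra_simps fun_eq_iff)

lemma flow_from_add_to: "s \<noteq> t \<Longrightarrow> flow_from s t N c (add_to s t c)"
  unfolding flow_from_def
  by (rule exI[of _ "\<lambda>v. if v = t then c else 0"]) (auto simp: add_to_def fun_eq_iff)

lemma flow_into_add_to: "s \<noteq> t \<Longrightarrow> flow_into s t N c (add_to s t c)"
  unfolding flow_into_def
  by (rule exI[of _ "\<lambda>r. c * r s"])
    (auto simp: add_to_def fun_eq_iff additive_map_def algebra_simps unit_vec_def)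

section \<open>Parallel composition of flows, for sums\<close>

lemma add_to_parallel: "s \<noteq> t \<Longrightarrow> add_to s t d \<circ> add_to s t c = add_to s t (c + d)"
  by (auto simp: add_to_def fun_eq_iff algebra_simps)

lemma flow_unit:
  assumes "flow s t N c U" "s \<noteq> t" "s \<notin> N"
  obtains w where "U (unit_vec s) = unit_vec s + w" "\<forall>v. v \<notin> insert t N \<longrightarrow> w v = 0" "w t = c"
proof
  show "U (unit_vec s) = unit_vec s + (unit_vec s + U (unit_vec s))" by simp
  show "\<forall>v. v \<notin> insert t N \<longrightarrow> (unit_vec s + U (unit_vec s)) v = 0"
    using assms by (auto simp: flow_def)
  show "(unit_vec s + U (unit_vec s)) t = c"
    using assms by (auto simp: flow_def unit_vec_def)
qed

text \<open>What the first map adds to the unit vector of the source lives on \<open>t\<close> and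
  \<open>N\<close>, which the second map does not read, so the two contributions to \<open>t\<close>
  simply add up.\<close>

lemma flow_parallel:
  assumes U: "flow s t N c U" and U': "flow s t N' d U'"
    and "N \<inter> N' = {}" "s \<noteq> t" "s \<notin> N" "s \<notin> N'" "t \<notin> N" "t \<notin> N'"
  shows "flow s t (N \<union> N') (c + d) (U' \<circ> U)"
proof -
  obtain w where w: "U (unit_vec s) = unit_vec s + w" "\<forall>v. v \<notin> insert t N \<longrightarrow> w v = 0" "w t = c"
    using flow_unit[OF U] assms by metis
  have "U' (unit_vec s + w) = U' (unit_vec s) + U' w"
    using U' by (simp add: flow_def additive_map_def)
  also have "U' w = w"
  proof -
    have "\<forall>v\<in>insert s N'. w v = 0" using assms w(2) by (metis disjoint_iff insert_iff)
    then show ?thesis using U' by (simp add: flow_def)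
  qed
  finally have "U' (U (unit_vec s)) = U' (unit_vec s) + w" by (simp only: w(1))
  then have "U' (U (unit_vec s)) t = c + d"
    using U' w(3) by (simp add: flow_def add.commute)
  then show ?thesis
    using U U' by (auto simp: flow_def additive_map_def)
qed

lemma flow_from_parallel:
  assumes "flow_from s t N c U" "flow_from s t N' d U'" "s \<noteq> t" "s \<notin> N"
  shows "flow_from s t (N \<union> N') (c + d) (U' \<circ> U)"
proof -
  from assms obtain u u' where u: "\<forall>v. v \<notin> insert t N \<longrightarrow> u v = 0" "u t = c"
      "U = (\<lambda>r. if r s = 1 then r + u else r)"
    and u': "\<forall>v. v \<notin> insert t N' \<longrightarrow> u' v = 0" "u' t = d"
      "U' = (\<lambda>r. if r s = 1 then r + u' else r)"
    by (auto simp: flow_from_def)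
  have "U' \<circ> U = (\<lambda>r. if r s = 1 then r + (u + u') else r)"
    using assms u u' by (auto simp: fun_eq_iff algebra_simps)
  then show ?thesis
    unfolding flow_from_def using u u' by (intro exI[of _ "u + u'"]) auto
qed

lemma additive_upd:
  assumes "additive_map \<phi>" "\<forall>r. (\<forall>v\<in>insert s N. r v = 0) \<longrightarrow> \<phi> r = (0::bit)" "s \<noteq> t" "t \<notin> N"
  shows "\<phi> (r(t := b)) = \<phi> r"
proof -
  \<comment> \<open>In characteristic 2 this sum is the difference of the two vectors; it lives on
    \<open>t\<close>, which \<phi> does not read.\<close>
  have "\<forall>v\<in>insert s N. (r + r(t := b)) v = 0"
    using assms(3,4) by auto
  then have "\<phi> (r + r(t := b)) = 0" using assms(2) by blast
  then have "\<phi> (r + (r + r(t := b))) = \<phi> r" using assms(1) unfolding additive_map_def by (metis add.right_neutral)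
  then show ?thesis by simp
qed

lemma flow_into_parallel:
  assumes "flow_into s t N c U" "flow_into s t N' d U'" "s \<noteq> t" "t \<notin> N'"
  shows "flow_into s t (N \<union> N') (c + d) (U' \<circ> U)"
proof -
  from assms obtain \<phi> \<phi>' where \<phi>: "additive_map \<phi>" "\<forall>r. (\<forall>v\<in>insert s N. r v = 0) \<longrightarrow> \<phi> r = 0"
      "\<phi> (unit_vec s) = c" "U = (\<lambda>r. r(t := r t + \<phi> r))"
    and \<phi>': "additive_map \<phi>'" "\<forall>r. (\<forall>v\<in>insert s N'. r v = 0) \<longrightarrow> \<phi>' r = 0"
      "\<phi>' (unit_vec s) = d" "U' = (\<lambda>r. r(t := r t + \<phi>' r))"
    by (auto simp: flow_into_def)
  have "\<phi>' (r(t := b)) = \<phi>' r" for r b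
    using additive_upd[OF \<phi>'(1,2)] assms by simp
  then have "U' \<circ> U = (\<lambda>r. r(t := r t + (\<phi> r + \<phi>' r)))"
    unfolding \<phi>(4) \<phi>'(4) by (auto simp: fun_eq_iff add.assoc)
  then show ?thesis
    unfolding flow_into_def using \<phi> \<phi>'
    by (intro exI[of _ "\<lambda>r. \<phi> r + \<phi>' r"]) (auto simp: additive_map_def algebra_simps)
qed

section \<open>Serial composition through an inner node \<open>m\<close>, for products\<close>

context
  fixes s m t :: nat and N N' :: "nat set"
  assumes distinct: "s \<noteq> m" "s \<noteq> t" "m \<noteq> t" "s \<notin> N" "s \<notin> N'" "m \<notin> N" "m \<notin> N'" "t \<notin> N" "t \<notin> N'"
    and disj: "N \<inter> N' = {}"
begin

text \<open>The second map reads only \<open>m\<close> and \<open>N'\<close>, and \<open>w\<close>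
  vanishes on \<open>N'\<close>, so only the bit \<open>w m\<close> matters. If it is 1, then
  \<open>w\<close> is the unit vector of \<open>m\<close> plus a vector that \<open>U'\<close>
  fixes.\<close>

lemma flow_split_image:
  assumes U': "flow m t N' d U'" and w: "\<forall>v. v \<notin> insert m N \<longrightarrow> w v = 0" "w m = c"
  shows "U' w t = c * d" "v \<notin> insert m (insert t (N \<union> N')) \<Longrightarrow> U' w v = 0"
proof -
  show "U' w v = 0" if "v \<notin> insert m (insert t (N \<union> N'))"
    using that U' w by (auto simp: flow_def)
  show "U' w t = c * d"
  proof (cases "c = 0")
    case True
    then have "\<forall>v\<in>insert m N'. w v = 0" using w distinct disj True by (metis disjoint_iff insert_iff)
    then have "U' w = w" using U' by (simp add: flow_def)
    then show ?thesis using w distinct True by auto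
  next
    case False
    define n where "n = unit_vec m + w"
    have "\<forall>v\<in>insert m N'. n v = 0"
      using w distinct disj False by (auto simp: n_def unit_vec_def disjoint_iff)
    then have n: "U' n = n" using U' by (simp add: flow_def)
    have "w = unit_vec m + n" by (simp add: n_def)
    then have "U' w = U' (unit_vec m) + n"
      using U' n by (metis flow_def additive_map_def)
    then show ?thesis
      using U' w distinct False by (auto simp: flow_def n_def unit_vec_def)
  qed
qed

lemma flow_serial:
  assumes U: "flow s m N c U" and U': "flow m t N' d U'"
  shows "flow s t (insert m (N \<union> N')) (c * d) (U' \<circ> U)"
proof -
  obtain w where w: "U (unit_vec s) = unit_vec s + w" "\<forall>v. v \<notin> insert m N \<longrightarrow> w v = 0" "w m = c"
    using flow_unit[OF U] distinct by metis
  have "\<forall>v\<in>insert m N'. unit_vec s v = 0"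
    using distinct by (auto simp: unit_vec_def)
  then have "U' (unit_vec s) = unit_vec s"
    using U' by (simp add: flow_def)
  then have "U' (U (unit_vec s)) = unit_vec s + U' w"
    using U' w(1) by (simp add: flow_def additive_map_def)
  then have "U' (U (unit_vec s)) t = c * d"
    using flow_split_image(1)[OF U' w(2,3)] distinct by (simp add: unit_vec_def)
  then show ?thesis
    using U U' by (auto simp: flow_def additive_map_def)
qed

text \<open>\<open>U'\<close> is additive and leaves register \<open>s\<close> alone, so conjugation
  by it turns "add \<open>u\<close> if \<open>r s = 1\<close>" into "add \<open>U' u\<close> if
  \<open>r s = 1\<close>": all other effects of \<open>U'\<close> cancel.\<close>

lemma flow_from_serial:
  assumes U: "flow_from s m N c U" and U': "flow m t N' d U'" and "bij U'"
  shows "flow_from s t (insert m (N \<union> N')) (c * d) (U' \<circ> U \<circ> inv U')"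
proof -
  from U obtain u where u: "\<forall>v. v \<notin> insert m N \<longrightarrow> u v = 0" "u m = c"
      "U = (\<lambda>r. if r s = 1 then r + u else r)"
    by (auto simp: flow_from_def)
  have inv: "inv U' r s = r s" for r
    using U' distinct surj_f_inv_f[OF bij_is_surj[OF \<open>bij U'\<close>]] by (metis flow_def insert_iff)
  have "(U' \<circ> U \<circ> inv U') = (\<lambda>r. if r s = 1 then r + U' u else r)"
    using U' surj_f_inv_f[OF bij_is_surj[OF \<open>bij U'\<close>]]
    by (auto simp: fun_eq_iff u(3) inv flow_def additive_map_def)
  then show ?thesis
    unfolding flow_from_def using flow_split_image[OF U' u(1,2)]
    by (intro exI[of _ "U' u"]) auto
qed

lemma flow_into_split_image:
  assumes \<phi>: "additive_map \<phi>" "\<forall>r. (\<forall>v\<in>insert m N'. r v = 0) \<longrightarrow> \<phi> r = 0" "\<phi> (unit_vec m) = (d::bit)"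
    and w: "\<forall>v. v \<notin> insert m N \<longrightarrow> w v = 0" "w m = c"
  shows "\<phi> w = c * d"
proof (cases "c = 0")
  case True
  then have "\<forall>v\<in>insert m N'. w v = 0" using w distinct disj True by (metis disjoint_iff insert_iff)
  then show ?thesis using \<phi> True by auto
next
  case False
  define n where "n = unit_vec m + w"
  have "\<forall>v\<in>insert m N'. n v = 0"
    using w distinct disj False by (auto simp: n_def unit_vec_def disjoint_iff)
  then have n: "\<phi> n = 0" using \<phi> by auto
  have "w = unit_vec m + n" by (simp add: n_def)
  then have "\<phi> w = \<phi> (unit_vec m) + \<phi> n"
    using \<phi> by (metis additive_map_def)
  then show ?thesis using n \<phi> False by simp
qed

text \<open>Dual to the previous conjugation: the functional \<phi> is replaced by \<phi> after
  \<open>U\<close>. What \<open>U\<close> wrote is undone by \<open>inv U\<close>, and the addition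
  to \<open>t\<close> survives because \<open>U\<close> does not read \<open>t\<close>.\<close>

lemma flow_into_serial:
  assumes U: "flow s m N c U" and U': "flow_into m t N' d U'" and "bij U"
  shows "flow_into s t (insert m (N \<union> N')) (c * d) (inv U \<circ> U' \<circ> U)"
proof -
  from U' obtain \<phi> where \<phi>: "additive_map \<phi>" "\<forall>r. (\<forall>v\<in>insert m N'. r v = 0) \<longrightarrow> \<phi> r = 0"
      "\<phi> (unit_vec m) = d" "U' = (\<lambda>r. r(t := r t + \<phi> r))"
    by (auto simp: flow_into_def)
  obtain w where w: "U (unit_vec s) = unit_vec s + w" "\<forall>v. v \<notin> insert m N \<longrightarrow> w v = 0" "w m = c"
    using flow_unit[OF U] distinct by metis
  have "\<forall>v\<in>insert m N'. unit_vec s v = 0"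
    using distinct by (auto simp: unit_vec_def)
  then have "\<phi> (unit_vec s) = 0" using \<phi>(2) by blast
  then have 1: "\<phi> (U (unit_vec s)) = c * d"
    using \<phi>(1) w(1) flow_into_split_image[OF \<phi>(1-3) w(2,3)] by (simp add: additive_map_def)
  have eq: "(inv U \<circ> U' \<circ> U) r = r(t := r t + \<phi> (U r))" for r
  proof -
    let ?e = "(\<lambda>v. if v = t then \<phi> (U r) else 0) :: nat \<Rightarrow> bit"
    have *: "q(t := q t + \<phi> (U r)) = q + ?e" for q by auto
    have "U ?e = ?e" using U distinct by (auto simp: flow_def)
    then have "U (r(t := r t + \<phi> (U r))) = U' (U r)"
      using U unfolding \<phi>(4) * by (auto simp: flow_def additive_map_def)
    then show ?thesis using \<open>bij U\<close> by (metis bij_inv_eq_iff comp_apply)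
  qed
  have "additive_map (\<lambda>r. \<phi> (U r))"
    using U \<phi> by (simp add: flow_def additive_map_def)
  moreover have "\<phi> (U r) = 0" if "\<forall>v\<in>insert s (insert m (N \<union> N')). r v = 0" for r
    using that U \<phi>(2) by (auto simp: flow_def)
  ultimately show ?thesis
    unfolding flow_into_def using eq 1
    by (intro exI[of _ "\<lambda>r. \<phi> (U r)"]) (auto simp del: comp_apply)
qed

text \<open>As \<open>u\<close> vanishes at \<open>s\<close> and \<phi> does not read
  \<open>t\<close>, both \<open>X\<close> and \<open>Y\<close> are involutions and the word is a
  commutator. The two runs of \<open>Y\<close> evaluate \<phi> at vectors that differ by
  \<open>u\<close> exactly if \<open>r s = 1\<close>, so \<open>t\<close> gains \<open>r s\<close>
  times \<open>\<phi> u\<close>, and the two additions of \<open>u\<close> cancel.\<close>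

lemma commutator_flow:
  assumes U: "flow_from s m N c X" and U': "flow_into m t N' d Y"
  shows "X \<circ> Y \<circ> X \<circ> Y = add_to s t (c * d)"
proof
  fix r
  from U obtain u where u: "\<forall>v. v \<notin> insert m N \<longrightarrow> u v = 0" "u m = c"
      "X = (\<lambda>r. if r s = 1 then r + u else r)"
    by (auto simp: flow_from_def)
  from U' obtain \<phi> where \<phi>: "additive_map \<phi>" "\<forall>r. (\<forall>v\<in>insert m N'. r v = 0) \<longrightarrow> \<phi> r = 0"
      "\<phi> (unit_vec m) = d" "Y = (\<lambda>r. r(t := r t + \<phi> r))"
    by (auto simp: flow_into_def)
  have \<phi>_upd: "\<phi> (r(t := b)) = \<phi> r" for r b
    using additive_upd[OF \<phi>(1,2)] distinct by simp
  have \<phi>_add: "\<phi> (r + r') = \<phi> r + \<phi> r'" for r r' using \<phi>(1) by (simp add: additive_map_def)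
  have "u s = 0" "u t = 0" using u(1) distinct by auto
  then show "(X \<circ> Y \<circ> X \<circ> Y) r = add_to s t (c * d) r"
    using distinct flow_into_split_image[OF \<phi>(1-3) u(1,2)]
    by (auto simp: u(3) \<phi>(4) add_to_def fun_eq_iff \<phi>_upd \<phi>_add algebra_simps)
qed

end


section \<open>Arithmetic formulas over GF(2)\<close>

text \<open>A constant has every size, so the last argument is an upper bound on the number of
  variable occurrences.\<close>

inductive arith :: "'i set \<Rightarrow> (('i \<Rightarrow> bool) \<Rightarrow> bit) \<Rightarrow> nat \<Rightarrow> bool" for V where
  const: "arith V (\<lambda>_. c) n"
| var: "i \<in> V \<Longrightarrow> arith V (\<lambda>z. of_bool (z i)) 1"
| add: "arith V f a \<Longrightarrow> arith V g b \<Longrightarrow> arith V (\<lambda>z. f z + g z) (a + b)"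
| mult: "arith V f a \<Longrightarrow> arith V g b \<Longrightarrow> arith V (\<lambda>z. f z * g z) (a + b)"

lemma arith_mono:
  assumes "arith V f a" "a \<le> b"
  shows "arith V f b"
  using arith.add[OF arith.const[of V 0 "b - a"] assms(1)] assms(2) by simp

lemma of_bool_conj_bit: "of_bool (P \<and> Q) = (of_bool P * of_bool Q :: bit)"
  by simp

lemma of_bool_disj_bit: "of_bool (P \<or> Q) = (1 + (1 + of_bool P) * (1 + of_bool Q) :: bit)"
  by simp

text \<open>Conjunction is a product, exclusive or a sum, and disjunction follows by De Morgan with
  negation as \<open>1 + _\<close>. Constants can have size 0, so the size is exactly the number of
  leaves.\<close>

lemma arith_eval: "vars F \<subseteq> V \<Longrightarrow> arith V (\<lambda>z. of_bool (eval z F)) (leaves F)"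
proof (induction F)
  case (Var i)
  then show ?case using arith.var[of i V] by simp
next
  case (And Fs)
  then show ?case
  proof (induction Fs)
    case Nil
    then show ?case using arith.const[of V 1 0] by simp
  next
    case (Cons F Fs)
    then have "arith V (\<lambda>z. of_bool (eval z F) * of_bool (eval z (And Fs))) (leaves F + leaves (And Fs))"
      by (intro arith.mult) auto
    then show ?case by (simp add: of_bool_conj_bit)
  qed
next
  case (Or Fs)
  then show ?case
  proof (induction Fs)
    case Nil
    then show ?case using arith.const[of V 0 0] by simp
  next
    case (Cons F Fs)
    then have "arith V (\<lambda>z. 1 + (1 + of_bool (eval z F)) * (1 + of_bool (eval z (Or Fs))))
        (0 + ((0 + leaves F) + (0 + leaves (Or Fs))))"
      by (intro arith.add arith.mult arith.const) auto
    then show ?case by (simp only: eval.simps leaves.simps list.set bex_simps of_bool_disj_bit 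
        list.map sum_list.Cons add_0) 
  qed
next
  case (Xor Fs)
  then show ?case
  proof (induction Fs)
    case Nil
    then show ?case using arith.const[of V 0 0] by simp
  next
    case (Cons F Fs)
    then have "arith V (\<lambda>z. of_bool (eval z F) + of_bool (eval z (Xor Fs))) (leaves F + leaves (Xor Fs))"
      by (intro arith.add) auto
    moreover have "(of_bool (eval z (Xor (F # Fs))) :: bit) = of_bool (eval z F) + of_bool (eval z (Xor Fs))" for z
      by simp
    ultimately show ?case by simp
  qed
qed

text \<open>The functions with at most one variable occurrence: constants, variables and negated
  variables.\<close>

definition affine :: "'i set \<Rightarrow> (('i \<Rightarrow> bool) \<Rightarrow> bit) \<Rightarrow> bool" where
  "affine V f \<longleftrightarrow> (\<exists>c. f = (\<lambda>_. c)) \<or> (\<exists>i\<in>V. \<exists>c. f = (\<lambda>z. of_bool (z i) + c))"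

lemma affine_add_const:
  assumes "affine V f"
  shows "affine V (\<lambda>z. f z + d)"
proof -
  from assms consider c where "f = (\<lambda>_. c)" | i c where "i \<in> V" "f = (\<lambda>z. of_bool (z i) + c)"
    by (auto simp: affine_def)
  then show ?thesis
  proof cases
    case 2
    then have "(\<lambda>z. f z + d) = (\<lambda>z. of_bool (z i) + (c + d))" by (simp add: add.assoc)
    then show ?thesis using 2(1) unfolding affine_def by blast
  qed (auto simp: affine_def)
qed

lemma affine_mult_const: "affine V f \<Longrightarrow> affine V (\<lambda>z. f z * d)"
  by (cases d) (auto simp: affine_def)

lemma arith_zero_size:
  assumes "arith V f a" "a = 0"
  obtains c where "f = (\<lambda>_. c)"
proof -
  have "\<exists>c. \<forall>z. f z = c" using assms by (induction rule: arith.induct) auto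
  then show thesis using that by blast
qed

lemma arith_le_1:
  assumes "arith V f a" "a \<le> 1"
  shows "affine V f"
  using assms
proof (induction rule: arith.induct)
  case (var i)
  then show ?case by (force simp: affine_def)
next
  case (add f a g b)
  then consider "a = 0" "b \<le> 1" | "b = 0" "a \<le> 1" by linarith
  then show ?case
  proof cases
    case 1
    obtain c where "f = (\<lambda>_. c)" using arith_zero_size[OF add.hyps(1) 1(1)] .
    then show ?thesis using affine_add_const[OF add.IH(2)[OF 1(2)], of c] by (simp add: add.commute)
  next
    case 2
    obtain c where "g = (\<lambda>_. c)" using arith_zero_size[OF add.hyps(2) 2(1)] .
    then show ?thesis using affine_add_const[OF add.IH(1)[OF 2(2)], of c] by simp
  qed
next
  case (mult f a g b)
  then consider "a = 0" "b \<le> 1" | "b = 0" "a \<le> 1" by linarith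
  then show ?case
  proof cases
    case 1
    obtain c where "f = (\<lambda>_. c)" using arith_zero_size[OF mult.hyps(1) 1(1)] .
    then show ?thesis using affine_mult_const[OF mult.IH(2)[OF 1(2)], of c] by (simp add: mult.commute)
  next
    case 2
    obtain c where "g = (\<lambda>_. c)" using arith_zero_size[OF mult.hyps(2) 2(1)] .
    then show ?thesis using affine_mult_const[OF mult.IH(1)[OF 2(2)], of c] by simp
  qed
qed (auto simp: affine_def)


section \<open>Splitting a formula into a bounded number of small pieces\<close>

text \<open>The first number counts the pieces, the second is their total size. What counts as a
  piece is left to \<open>P\<close>, so that pieces can later be replaced by programs.\<close>

inductive skeleton :: "((('i \<Rightarrow> bool) \<Rightarrow> bit) \<Rightarrow> nat \<Rightarrow> bool) \<Rightarrow> (('i \<Rightarrow> bool) \<Rightarrow> bit) \<Rightarrow> nat \<Rightarrow> nat \<Rightarrow> bool"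
  for P
where
  leaf: "P f a \<Longrightarrow> skeleton P f 1 a"
| add: "skeleton P f m a \<Longrightarrow> skeleton P g n b \<Longrightarrow> skeleton P (\<lambda>z. f z + g z) (m + n) (a + b)"
| mult: "skeleton P f m a \<Longrightarrow> skeleton P g n b \<Longrightarrow> skeleton P (\<lambda>z. f z * g z) (m + n) (a + b)"

lemma skeleton_pos: "skeleton P f m a \<Longrightarrow> m \<ge> 1"
  by (induction rule: skeleton.induct) auto

text \<open>Processing the formula bottom-up, the part of it that is not yet in the skeleton \<open>R\<close> is a
  context \<open>\<alpha> R + \<beta>\<close> of size \<open>m \<le> M\<close>. A context is moved into the skeleton when it would
  grow beyond \<open>M\<close> or when it meets another one; \<open>w\<close> is the size of the part of the formula that
  the skeleton covers.\<close>

definition open_context :: "'i set \<Rightarrow> nat \<Rightarrow> (('i \<Rightarrow> bool) \<Rightarrow> bit) \<Rightarrow> nat \<Rightarrow> bool" where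
  "open_context V M f s \<longleftrightarrow> (\<exists>\<alpha> R \<beta> m q w l. f = (\<lambda>z. \<alpha> z * R z + \<beta> z) \<and> arith V \<alpha> m \<and> arith V \<beta> m \<and>
     skeleton (\<lambda>g b. arith V g b \<and> b \<le> M) R q l \<and> m \<le> M \<and> m + w \<le> s \<and> l \<le> 2 * w \<and>
     (q + 4) * M \<le> 7 * w)"

lemma open_contextI:
  assumes "arith V \<alpha> m" "arith V \<beta> m" "skeleton (\<lambda>g b. arith V g b \<and> b \<le> M) R q l"
    "m \<le> M" "m + w \<le> s" "l \<le> 2 * w" "(q + 4) * M \<le> 7 * w" "\<And>z. f z = \<alpha> z * R z + \<beta> z"
  shows "open_context V M f s"
proof -
  have "f = (\<lambda>z. \<alpha> z * R z + \<beta> z)" using assms(8) by blast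
  then show ?thesis unfolding open_context_def using assms(1-7) by blast
qed

lemma open_context_closed:
  assumes "skeleton (\<lambda>g b. arith V g b \<and> b \<le> M) f q l" "l \<le> 2 * s" "(q + 4) * M \<le> 7 * s"
  shows "open_context V M f s"
  by (rule open_contextI[OF arith.const[of V 1 0] arith.const[of V 0 0] assms(1), of s]) (use assms in auto)

text \<open>Closing a context turns \<alpha> and \<beta> into two further pieces. Each has size at
  most \<open>m\<close>, which is the origin of the factor 2 in
  \<open>l \<le> 2 * s\<close>.\<close>

lemma open_context_skeleton:
  assumes "open_context V M f s"
  obtains q l where "skeleton (\<lambda>g b. arith V g b \<and> b \<le> M) f q l" "l \<le> 2 * s" "(q + 2) * M \<le> 7 * s"
proof -
  from assms obtain \<alpha> R \<beta> m q w l where *: "f = (\<lambda>z. \<alpha> z * R z + \<beta> z)" "arith V \<alpha> m" "arith V \<beta> m"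
    "skeleton (\<lambda>g b. arith V g b \<and> b \<le> M) R q l" "m \<le> M" "m + w \<le> s" "l \<le> 2 * w"
    "(q + 4) * M \<le> 7 * w"
    unfolding open_context_def by blast
  have "skeleton (\<lambda>g b. arith V g b \<and> b \<le> M) f ((1 + q) + 1) ((m + l) + m)"
    unfolding *(1) using * by (intro skeleton.intros conjI)
  moreover have "(1 + q + 1 + 2) * M \<le> 7 * s"
    using *(6,8) by (simp add: algebra_simps)
  ultimately show thesis using * by (intro that) auto
qed

text \<open>The summand is absorbed by \<beta> as long as the context stays within \<open>M\<close>.
  On overflow, \<alpha>, \<beta> and \<open>g\<close> become three new pieces, paid for by the more
  than \<open>M\<close> units of size that the skeleton newly covers.\<close>

lemma open_context_add_small:
  assumes "open_context V M f a" "arith V g b" "b \<le> M"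
  shows "open_context V M (\<lambda>z. f z + g z) (a + b)"
proof -
  from assms(1) obtain \<alpha> R \<beta> m q w l where *: "f = (\<lambda>z. \<alpha> z * R z + \<beta> z)" "arith V \<alpha> m" "arith V \<beta> m"
    "skeleton (\<lambda>g b. arith V g b \<and> b \<le> M) R q l" "m \<le> M" "m + w \<le> a" "l \<le> 2 * w"
    "(q + 4) * M \<le> 7 * w"
    unfolding open_context_def by blast
  show ?thesis
  proof (cases "m + b \<le> M")
    case True
    show ?thesis
      by (rule open_contextI[OF arith_mono[OF *(2)] arith.add[OF *(3) assms(2)] *(4), of w])
        (use * True in \<open>auto simp: algebra_simps\<close>)
  next
    case False
    have sk: "skeleton (\<lambda>g b. arith V g b \<and> b \<le> M) (\<lambda>z. f z + g z) (((1 + q) + 1) + 1) (((m + l) + m) + b)"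
      unfolding *(1) using * assms by (intro skeleton.intros conjI)
    show ?thesis
      by (rule open_context_closed[OF sk]) (use * False in \<open>auto simp: algebra_simps\<close>)
  qed
qed

text \<open>A factor is absorbed by \<alpha> and \<beta> simultaneously. This duplication is why one
  number \<open>m\<close> bounds the size of each of them instead of their sum.\<close>

lemma open_context_mult_small:
  assumes "open_context V M f a" "arith V g b" "b \<le> M"
  shows "open_context V M (\<lambda>z. f z * g z) (a + b)"
proof -
  from assms(1) obtain \<alpha> R \<beta> m q w l where *: "f = (\<lambda>z. \<alpha> z * R z + \<beta> z)" "arith V \<alpha> m" "arith V \<beta> m"
    "skeleton (\<lambda>g b. arith V g b \<and> b \<le> M) R q l" "m \<le> M" "m + w \<le> a" "l \<le> 2 * w"
    "(q + 4) * M \<le> 7 * w"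
    unfolding open_context_def by blast
  show ?thesis
  proof (cases "m + b \<le> M")
    case True
    show ?thesis
      by (rule open_contextI[OF arith.mult[OF *(2) assms(2)] arith.mult[OF *(3) assms(2)] *(4), of w])
        (use * True in \<open>auto simp: algebra_simps\<close>)
  next
    case False
    have sk: "skeleton (\<lambda>g b. arith V g b \<and> b \<le> M) (\<lambda>z. f z * g z) (((1 + q) + 1) + 1) (((m + l) + m) + b)"
      unfolding *(1) using * assms by (intro skeleton.intros conjI)
    show ?thesis
      by (rule open_context_closed[OF sk]) (use * False in \<open>auto simp: algebra_simps\<close>)
  qed
qed

lemma open_context_combine:
  assumes "open_context V M f a" "open_context V M g b"
  shows "open_context V M (\<lambda>z. f z + g z) (a + b)" "open_context V M (\<lambda>z. f z * g z) (a + b)"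
proof -
  from assms(1) obtain \<alpha> R \<beta> m q w l where *: "f = (\<lambda>z. \<alpha> z * R z + \<beta> z)" "arith V \<alpha> m" "arith V \<beta> m"
    "skeleton (\<lambda>g b. arith V g b \<and> b \<le> M) R q l" "m \<le> M" "m + w \<le> a" "l \<le> 2 * w"
    "(q + 4) * M \<le> 7 * w"
    unfolding open_context_def by blast
  from assms(2) obtain \<alpha>' R' \<beta>' m' q' w' l' where **: "g = (\<lambda>z. \<alpha>' z * R' z + \<beta>' z)"
    "arith V \<alpha>' m'" "arith V \<beta>' m'"
    "skeleton (\<lambda>g b. arith V g b \<and> b \<le> M) R' q' l'" "m' \<le> M" "m' + w' \<le> b" "l' \<le> 2 * w'"
    "(q' + 4) * M \<le> 7 * w'"
    unfolding open_context_def by blast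
  have f: "skeleton (\<lambda>g b. arith V g b \<and> b \<le> M) f ((1 + q) + 1) ((m + l) + m)"
    unfolding *(1) using * by (intro skeleton.intros conjI)
  have g: "skeleton (\<lambda>g b. arith V g b \<and> b \<le> M) g ((1 + q') + 1) ((m' + l') + m')"
    unfolding **(1) using ** by (intro skeleton.intros conjI)
  \<comment> \<open>Closing both contexts creates four pieces. The surplus 4 of one invariant pays
    for them, and the surplus of the other is kept for the new context.\<close>
  have "((1 + q) + 1 + ((1 + q') + 1) + 4) * M \<le> 7 * (a + b)"
    using *(6,8) **(6,8) by (simp add: algebra_simps)
  then show "open_context V M (\<lambda>z. f z + g z) (a + b)" "open_context V M (\<lambda>z. f z * g z) (a + b)"
    using * ** open_context_closed[OF skeleton.add[OF f g], of "a + b"]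
      open_context_closed[OF skeleton.mult[OF f g], of "a + b"] by simp_all
qed

lemma open_context_mono: "open_context V M f a \<Longrightarrow> a \<le> b \<Longrightarrow> open_context V M f b"
  unfolding open_context_def by clarify (intro exI conjI, rule refl, assumption+, auto)

text \<open>Sizes are only upper bounds, so "small" has to mean that some size at most
  \<open>M\<close> is possible; a constant with a huge size is still small.\<close>

lemma arith_open_context:
  assumes "arith V f s" "M > 0"
  shows "(\<exists>a\<le>s. a \<le> M \<and> arith V f a) \<or> open_context V M f s"
  using assms(1)
proof (induction rule: arith.induct)
  case (const c n)
  then show ?case by (auto intro: arith.const)
next
  case (var i)
  then show ?case using assms(2) by (auto intro!: exI[of _ 1] arith.var)
next
  case (add f a g b)
  have *: "(\<exists>a'\<le>a + b. a' \<le> M \<and> arith V (\<lambda>z. f z + g z) a') \<or> open_context V M (\<lambda>z. f z + g z) (a + b)"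
    if f: "a' \<le> a" "a' \<le> M" "arith V f a'" and g: "b' \<le> b" "b' \<le> M" "arith V g b'" for a' b'
  proof (cases "a' + b' \<le> M")
    case True
    have "arith V (\<lambda>z. f z + g z) (a' + b')" using f g by (intro arith.add)
    then show ?thesis using True f g by (meson add_mono)
  next
    case False
    \<comment> \<open>A first skeleton of two pieces: it needs \<open>6 * M \<le> 7 * s\<close>,
      which holds since \<open>a' + b' > M\<close>.\<close>
    have "skeleton (\<lambda>g b. arith V g b \<and> b \<le> M) (\<lambda>z. f z + g z) (1 + 1) (a' + b')"
      using f g by (intro skeleton.intros conjI)
    then show ?thesis using False f g by (intro disjI2 open_context_closed) auto
  qed
  have **: "open_context V M (\<lambda>z. f z + g z) (a + b)"
    if "open_context V M f a" "b' \<le> b" "b' \<le> M" "arith V g b'" for b'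
    using that open_context_mono[OF open_context_add_small[of V M f a g b']] by simp
  have ***: "open_context V M (\<lambda>z. f z + g z) (a + b)"
    if "open_context V M g b" "a' \<le> a" "a' \<le> M" "arith V f a'" for a'
    using that open_context_mono[OF open_context_add_small[of V M g b f a'], of "a + b"]
    by (simp add: add.commute)
  show ?case
    using add.IH * ** *** open_context_combine(1) by blast
next
  case (mult f a g b)
  have *: "(\<exists>a'\<le>a + b. a' \<le> M \<and> arith V (\<lambda>z. f z * g z) a') \<or> open_context V M (\<lambda>z. f z * g z) (a + b)"
    if f: "a' \<le> a" "a' \<le> M" "arith V f a'" and g: "b' \<le> b" "b' \<le> M" "arith V g b'" for a' b'
  proof (cases "a' + b' \<le> M")
    case True
    have "arith V (\<lambda>z. f z * g z) (a' + b')" using f g by (intro arith.mult)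
    then show ?thesis using True f g by (meson add_mono)
  next
    case False
    have "skeleton (\<lambda>g b. arith V g b \<and> b \<le> M) (\<lambda>z. f z * g z) (1 + 1) (a' + b')"
      using f g by (intro skeleton.intros conjI)
    then show ?thesis using False f g by (intro disjI2 open_context_closed) auto
  qed
  have **: "open_context V M (\<lambda>z. f z * g z) (a + b)"
    if "open_context V M f a" "b' \<le> b" "b' \<le> M" "arith V g b'" for b'
    using that open_context_mono[OF open_context_mult_small[of V M f a g b']] by simp
  have ***: "open_context V M (\<lambda>z. f z * g z) (a + b)"
    if "open_context V M g b" "a' \<le> a" "a' \<le> M" "arith V f a'" for a'
    using that open_context_mono[OF open_context_mult_small[of V M g b f a'], of "a + b"]
    by (simp add: add.commute mult.commute)
  show ?case
    using mult.IH * ** *** open_context_combine(2) by blast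
qed

lemma arith_skeleton:
  assumes "arith V f s" "M > 0" "s \<le> B * M" "B > 0"
  obtains q l where "skeleton (\<lambda>g b. arith V g b \<and> b \<le> M) f q l" "l \<le> 2 * s" "q \<le> 7 * B"
proof -
  from arith_open_context[OF assms(1,2)] consider
    a where "a \<le> s" "a \<le> M" "arith V f a" | "open_context V M f s" by blast
  then show thesis
  proof cases
    case 1
    then have "skeleton (\<lambda>g b. arith V g b \<and> b \<le> M) f 1 a" by (intro skeleton.leaf) simp
    then show thesis using 1 assms(4) by (intro that[of 1 a]) auto
  next
    case 2
    then obtain q l where *: "skeleton (\<lambda>g b. arith V g b \<and> b \<le> M) f q l" "l \<le> 2 * s"
      "(q + 2) * M \<le> 7 * s"
      by (rule open_context_skeleton)
    have "(q + 2) * M \<le> 7 * (B * M)" using *(3) assms(3) by linarith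
    then have "q + 2 \<le> 7 * B" using assms(2) by (metis mult.assoc mult_le_cancel2)
    then show thesis using * by (intro that[of q l]) auto
  qed
qed


section \<open>Formulas by programs with few registers\<close>

text \<open>Registers from \<open>W\<close> on are frozen at 0: the state set is finite, while all
  maps remain bijections of the full function space.\<close>

definition regs :: "nat \<Rightarrow> (nat \<Rightarrow> bit) set" where
  "regs W = {r. \<forall>v\<ge>W. r v = 0}"

text \<open>Quantifying over all pairs of registers allows the program to be placed on any edge of a
  graph.\<close>

definition adds :: "'i set \<Rightarrow> nat \<Rightarrow> (('i \<Rightarrow> bool) \<Rightarrow> bit) \<Rightarrow> nat \<Rightarrow> bool" where
  "adds V W f n \<longleftrightarrow>
     (\<forall>s<W. \<forall>t<W. s \<noteq> t \<longrightarrow> perm_prog V (regs W) (\<lambda>z. add_to s t (f z)) n)"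

lemma add_to_self_inverse: "s \<noteq> t \<Longrightarrow> add_to s t c (add_to s t c r) = r"
  by (auto simp: add_to_def fun_eq_iff add.assoc)

lemma add_to_bij: "s \<noteq> t \<Longrightarrow> bij (add_to s t c)"
  by (metis add_to_self_inverse involuntory_imp_bij)

lemma add_to_regs:
  assumes "s \<noteq> t" "t < W"
  shows "add_to s t c ` regs W = regs W"
proof -
  have "add_to s t c r \<in> regs W" if "r \<in> regs W" for r
    using that assms by (auto simp: regs_def add_to_def)
  then show ?thesis using add_to_self_inverse[OF assms(1)]
    by (metis (no_types, lifting) image_iff subsetI subset_antisym)
qed

lemma adds_const: "adds V W (\<lambda>_. c) n"
  unfolding adds_def by (auto intro!: perm_prog.fixed add_to_bij add_to_regs)

lemma adds_var: "i \<in> V \<Longrightarrow> adds V W (\<lambda>z. of_bool (z i)) 1"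
  unfolding adds_def
proof (intro allI impI)
  fix s t assume *: "i \<in> V" "s < W" "t < W" "s \<noteq> t"
  have "(\<lambda>z. add_to s t (of_bool (z i))) = (\<lambda>z. if z i then add_to s t 1 else id)"
    by (auto simp: fun_eq_iff add_to_def)
  then show "perm_prog V (regs W) (\<lambda>z. add_to s t (of_bool (z i))) 1"
    using perm_prog.query[OF *(1) add_to_bij[OF *(4)] add_to_regs[OF *(4,3)]] by simp
qed

lemma adds_add:
  assumes "adds V W f a" "adds V W g b"
  shows "adds V W (\<lambda>z. f z + g z) (a + b)"
  unfolding adds_def
proof (intro allI impI)
  fix s t assume *: "s < W" "t < W" "s \<noteq> t"
  have "perm_prog V (regs W) (\<lambda>z. add_to s t (g z) \<circ> add_to s t (f z)) (b + a)"
    using assms * by (intro perm_prog.comp) (auto simp: adds_def)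
  then show "perm_prog V (regs W) (\<lambda>z. add_to s t (f z + g z)) (a + b)"
    by (simp only: add_to_parallel[OF *(3)] add.commute[of b a])
qed

text \<open>The invariant of the recursion, with costs 1, 2, 2 and 4 relative to \<open>n\<close>.
  In a product, a conjugation runs the plain flow of one factor twice and the cost-2 program of the
  other once, and the commutator runs two cost-2 programs twice each. The cost-4 programs of the
  factors are not reused there, so the cost does not grow with the depth.\<close>

definition flow_progs :: "'i set \<Rightarrow> nat \<Rightarrow> nat \<Rightarrow> nat \<Rightarrow> nat set \<Rightarrow> (('i \<Rightarrow> bool) \<Rightarrow> bit) \<Rightarrow> nat \<Rightarrow> bool" where
  "flow_progs V W s t N f n \<longleftrightarrow>
     (\<exists>A. perm_prog V (regs W) A n \<and> (\<forall>z. flow s t N (f z) (A z))) \<and>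
     (\<exists>A. perm_prog V (regs W) A (2 * n) \<and> (\<forall>z. flow_from s t N (f z) (A z))) \<and>
     (\<exists>A. perm_prog V (regs W) A (2 * n) \<and> (\<forall>z. flow_into s t N (f z) (A z))) \<and>
     perm_prog V (regs W) (\<lambda>z. add_to s t (f z)) (4 * n)"

lemma flow_progs_leaf:
  assumes "adds V W f n" "s < W" "t < W" "s \<noteq> t"
  shows "flow_progs V W s t N f n"
proof -
  have "perm_prog V (regs W) (\<lambda>z. add_to s t (f z)) n"
    using assms by (auto simp: adds_def)
  note * = perm_prog_mono[OF this]
  show ?thesis
    unfolding flow_progs_def
    using assms(4)
    by (intro conjI exI[of _ "\<lambda>z. add_to s t (f z)"] allI * flow_add_to flow_from_add_to
      flow_into_add_to) auto
qed

lemma flow_progs_parallel: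
  assumes "flow_progs V W s t N f a" "flow_progs V W s t N' g b"
    and "N \<inter> N' = {}" "s \<noteq> t" "s \<notin> N" "s \<notin> N'" "t \<notin> N" "t \<notin> N'"
  shows "flow_progs V W s t (N \<union> N') (\<lambda>z. f z + g z) (a + b)"
proof -
  from assms(1) obtain A1 A2 A3 where A:
    "perm_prog V (regs W) A1 a" "\<And>z. flow s t N (f z) (A1 z)"
    "perm_prog V (regs W) A2 (2 * a)" "\<And>z. flow_from s t N (f z) (A2 z)"
    "perm_prog V (regs W) A3 (2 * a)" "\<And>z. flow_into s t N (f z) (A3 z)"
    "perm_prog V (regs W) (\<lambda>z. add_to s t (f z)) (4 * a)"
    unfolding flow_progs_def by blast
  from assms(2) obtain B1 B2 B3 where B:
    "perm_prog V (regs W) B1 b" "\<And>z. flow s t N' (g z) (B1 z)"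
    "perm_prog V (regs W) B2 (2 * b)" "\<And>z. flow_from s t N' (g z) (B2 z)"
    "perm_prog V (regs W) B3 (2 * b)" "\<And>z. flow_into s t N' (g z) (B3 z)"
    "perm_prog V (regs W) (\<lambda>z. add_to s t (g z)) (4 * b)"
    unfolding flow_progs_def by blast
  have 1: "perm_prog V (regs W) (\<lambda>z. B1 z \<circ> A1 z) (a + b)"
    using perm_prog.comp[OF B(1) A(1)] by (simp add: add.commute)
  have 2: "perm_prog V (regs W) (\<lambda>z. B2 z \<circ> A2 z) (2 * (a + b))"
    using perm_prog.comp[OF B(3) A(3)] by (simp add: algebra_simps)
  have 3: "perm_prog V (regs W) (\<lambda>z. B3 z \<circ> A3 z) (2 * (a + b))"
    using perm_prog.comp[OF B(5) A(5)] by (simp add: algebra_simps)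
  have "perm_prog V (regs W) (\<lambda>z. add_to s t (g z) \<circ> add_to s t (f z)) (4 * (a + b))"
    using perm_prog.comp[OF B(7) A(7)] by (simp add: algebra_simps)
  then have 4: "perm_prog V (regs W) (\<lambda>z. add_to s t (f z + g z)) (4 * (a + b))"
    by (simp only: add_to_parallel[OF assms(4)])
  show ?thesis
    unfolding flow_progs_def
    using 1 flow_parallel[OF A(2) B(2) assms(3-8)] 2 flow_from_parallel[OF A(4) B(4) assms(4,5)]
      3 flow_into_parallel[OF A(6) B(6) assms(4,8)] 4 by blast
qed

lemma flow_progs_serial:
  assumes "flow_progs V W s m N f a" "flow_progs V W m t N' g b"
    and d: "s \<noteq> m" "s \<noteq> t" "m \<noteq> t" "s \<notin> N" "s \<notin> N'" "m \<notin> N" "m \<notin> N'" "t \<notin> N" "t \<notin> N'"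
      "N \<inter> N' = {}"
  shows "flow_progs V W s t (insert m (N \<union> N')) (\<lambda>z. f z * g z) (a + b)"
proof -
  from assms(1) obtain A1 A2 A3 where A:
    "perm_prog V (regs W) A1 a" "\<And>z. flow s m N (f z) (A1 z)"
    "perm_prog V (regs W) A2 (2 * a)" "\<And>z. flow_from s m N (f z) (A2 z)"
    "perm_prog V (regs W) A3 (2 * a)" "\<And>z. flow_into s m N (f z) (A3 z)"
    unfolding flow_progs_def by blast
  from assms(2) obtain B1 B2 B3 where B:
    "perm_prog V (regs W) B1 b" "\<And>z. flow m t N' (g z) (B1 z)"
    "perm_prog V (regs W) B2 (2 * b)" "\<And>z. flow_from m t N' (g z) (B2 z)"
    "perm_prog V (regs W) B3 (2 * b)" "\<And>z. flow_into m t N' (g z) (B3 z)"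
    unfolding flow_progs_def by blast
  have 1: "perm_prog V (regs W) (\<lambda>z. B1 z \<circ> A1 z) (a + b)"
    using perm_prog.comp[OF B(1) A(1)] by (simp add: add.commute)
  have 2: "perm_prog V (regs W) (\<lambda>z. B1 z \<circ> A2 z \<circ> inv (B1 z)) (2 * (a + b))"
    using perm_prog.comp[OF perm_prog.comp[OF B(1) A(3)] perm_prog_inv[OF B(1)]]
    by (simp add: algebra_simps)
  have 3: "perm_prog V (regs W) (\<lambda>z. inv (A1 z) \<circ> B3 z \<circ> A1 z) (2 * (a + b))"
    using perm_prog.comp[OF perm_prog.comp[OF perm_prog_inv[OF A(1)] B(5)] A(1)]
    by (simp add: algebra_simps)
  have "perm_prog V (regs W) (\<lambda>z. A2 z \<circ> B3 z \<circ> A2 z \<circ> B3 z) (4 * (a + b))"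
    using perm_prog.comp[OF perm_prog.comp[OF perm_prog.comp[OF A(3) B(5)] A(3)] B(5)]
    by (simp add: algebra_simps)
  then have 4: "perm_prog V (regs W) (\<lambda>z. add_to s t (f z * g z)) (4 * (a + b))"
    by (simp only: commutator_flow[OF d A(4) B(6)])
  show ?thesis
    unfolding flow_progs_def
    using 1 flow_serial[OF d A(2) B(2)] 2 flow_from_serial[OF d A(4) B(2) perm_prog_bij[OF B(1)]]
      3 flow_into_serial[OF d A(2) B(6) perm_prog_bij[OF A(1)]] 4 by blast
qed

text \<open>\<open>N\<close> is a pool of registers for the inner nodes. Only products create inner
  nodes, one each, so \<open>q\<close> leaves require at most \<open>q - 1\<close> of them; surplus
  registers may stay in the pool.\<close>

lemma skeleton_flow_progs:
  assumes "skeleton P f q l" and leaf: "\<And>g b. P g b \<Longrightarrow> adds V W g (D * b)"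
    and "N \<subseteq> {..<W}" "q \<le> card N + 1" "s < W" "t < W" "s \<noteq> t" "s \<notin> N" "t \<notin> N"
  shows "flow_progs V W s t N f (D * l)"
  using assms(1,3-)
proof (induction arbitrary: N s t rule: skeleton.induct)
  case (leaf f a)
  then show ?case using flow_progs_leaf[OF assms(2)] by blast
next
  case (add f m a g n b)
  have mn: "m \<ge> 1" "n \<ge> 1" using add.hyps skeleton_pos by blast+
  then have "m - 1 \<le> card N" using add.prems(2) by linarith
  then obtain N1 where N1: "N1 \<subseteq> N" "card N1 = m - 1"
    using obtain_subset_with_card_n by metis
  have "finite N" using add.prems(1) finite_subset by blast
  then have card: "card (N - N1) = card N - (m - 1)"
    using N1 by (metis card_Diff_subset finite_subset)
  have "flow_progs V W s t N1 f (D * a)" "flow_progs V W s t (N - N1) g (D * b)"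
    using N1 card mn add.prems by (intro add.IH; auto)+
  then have "flow_progs V W s t (N1 \<union> (N - N1)) (\<lambda>z. f z + g z) (D * a + D * b)"
    using N1 add.prems by (intro flow_progs_parallel) auto
  then show ?case using N1(1) by (simp add: Un_absorb1 algebra_simps)
next
  case (mult f m a g n b)
  have mn: "m \<ge> 1" "n \<ge> 1" using mult.hyps skeleton_pos by blast+
  have "finite N" using mult.prems(1) finite_subset by blast
  have "N \<noteq> {}" using mn mult.prems by auto
  \<comment> \<open>\<open>x\<close> becomes the node where the two factors meet; at least
    \<open>(m - 1) + (n - 1)\<close> registers remain for their inner nodes.\<close>
  then obtain x where x: "x \<in> N" by auto
  have cx: "card (N - {x}) = card N - 1" using x \<open>finite N\<close> by simp
  then have "m - 1 \<le> card (N - {x})" using mn mult.prems(2) by linarith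
  then obtain N1 where N1: "N1 \<subseteq> N - {x}" "card N1 = m - 1"
    using obtain_subset_with_card_n by metis
  then have card: "card (N - {x} - N1) = card N - 1 - (m - 1)"
    using \<open>finite N\<close> cx by (metis card_Diff_subset finite_Diff finite_subset)
  have "x < W" using x mult.prems(1) by auto
  then have "flow_progs V W s x N1 f (D * a)" "flow_progs V W x t (N - {x} - N1) g (D * b)"
    using N1 card mn mult.prems x by (intro mult.IH; auto)+
  then have "flow_progs V W s t (insert x (N1 \<union> (N - {x} - N1))) (\<lambda>z. f z * g z) (D * a + D * b)"
    using N1 mult.prems x by (intro flow_progs_serial) auto
  moreover have "insert x (N1 \<union> (N - {x} - N1)) = N" using N1 x by auto
  ultimately show ?case by (simp add: algebra_simps)
qed

lemma skeleton_adds: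
  assumes "skeleton P f q l" and "\<And>g b. P g b \<Longrightarrow> adds V W g (D * b)" and "q + 1 \<le> W"
  shows "adds V W f (4 * (D * l))"
  unfolding adds_def
proof (intro allI impI)
  fix s t assume *: "s < W" "t < W" "s \<noteq> t"
  \<comment> \<open>All registers except the two end points serve as the pool, and
    \<open>q + 1 \<le> W\<close> makes it large enough.\<close>
  have "card ({..<W} - {s, t}) = W - 2"
    using * by (subst card_Diff_subset) auto
  then have "flow_progs V W s t ({..<W} - {s, t}) f (D * l)"
    using assms * by (intro skeleton_flow_progs[of P f q]) auto
  then show "perm_prog V (regs W) (\<lambda>z. add_to s t (f z)) (4 * (D * l))"
    by (simp add: flow_progs_def)
qed

text \<open>The skeleton runs each piece 4 times and its pieces have total size at most
  \<open>2 * s\<close>, so each level costs a factor 8. All levels share the same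
  \<open>7 * B + 1\<close> registers, since \<open>adds\<close> assumes nothing about their
  contents.\<close>

lemma arith_adds:
  assumes "B > 0"
  shows "arith V f s \<Longrightarrow> s \<le> B ^ j \<Longrightarrow> adds V (7 * B + 1) f (8 ^ j * s)"
proof (induction j arbitrary: f s)
  case 0
  then have "s \<le> 1" by simp
  show ?case
  proof (cases "\<exists>c. f = (\<lambda>_. c)")
    case True
    then show ?thesis using adds_const by auto
  next
    case False
    then obtain i c where ic: "i \<in> V" "f = (\<lambda>z. of_bool (z i) + c)"
      using arith_le_1[OF 0(1) \<open>s \<le> 1\<close>] by (auto simp: affine_def)
    \<comment> \<open>A nonconstant function has size exactly 1 here, which pays for its
      query.\<close>
    have "s \<noteq> 0" using arith_zero_size[OF 0(1)] False by metis
    then show ?thesis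
      using \<open>s \<le> 1\<close> adds_add[OF adds_var[OF ic(1)] adds_const[of V _ c 0]]
      unfolding ic(2) by (simp add: le_Suc_eq)
  qed
next
  case (Suc j)
  have "B ^ j > 0" "s \<le> B * B ^ j" using assms Suc.prems by simp_all
  then obtain q l where *: "skeleton (\<lambda>g b. arith V g b \<and> b \<le> B ^ j) f q l" "l \<le> 2 * s" "q \<le> 7 * B"
    using arith_skeleton[OF Suc.prems(1) _ _ assms] by blast
  have "adds V (7 * B + 1) f (4 * (8 ^ j * l))"
    using *(3) Suc.IH by (intro skeleton_adds[OF *(1)]) auto
  moreover have "4 * (8 ^ j * l) \<le> 8 ^ Suc j * s" using *(2) by simp
  ultimately show ?case using perm_prog_mono unfolding adds_def by blast
qed


section \<open>Following a garden-hose path\<close>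

text \<open>A configuration is a vertex together with the player whose edge is followed next
  (\<open>True\<close> for Alice).\<close>

definition follow :: "'v set set \<Rightarrow> 'v set set \<Rightarrow> 'v \<times> bool \<Rightarrow> 'v \<times> bool \<Rightarrow> bool" where
  "follow A B p q \<longleftrightarrow> snd q = (\<not> snd p) \<and> {fst p, fst q} \<in> (if snd p then A else B)"

definition stuck :: "'v set set \<Rightarrow> 'v set set \<Rightarrow> 'v \<times> bool \<Rightarrow> bool" where
  "stuck A B p \<longleftrightarrow> (\<nexists>q. follow A B p q)"

definition halts_at :: "'v set set \<Rightarrow> 'v set set \<Rightarrow> 'v \<times> bool \<Rightarrow> 'v \<times> bool \<Rightarrow> bool" where
  "halts_at A B p q \<longleftrightarrow> (follow A B)\<^sup>*\<^sup>* p q \<and> stuck A B q"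

lemma follow_unique:
  assumes "matching W A" "matching V B" "follow A B p q" "follow A B p q'"
  shows "q = q'"
  using assms matching_unique by (auto simp: follow_def prod_eq_iff split: if_splits)

lemma halts_at_unique:
  assumes "matching W A" "matching V B" "halts_at A B p q" "halts_at A B p q'"
  shows "q = q'"
proof -
  have "(follow A B)\<^sup>*\<^sup>* p q" "(follow A B)\<^sup>*\<^sup>* p q'" "stuck A B q" "stuck A B q'"
    using assms by (auto simp: halts_at_def)
  then show ?thesis
  proof (induction rule: converse_rtranclp_induct)
    case base
    then show ?case by (metis converse_rtranclpE stuck_def)
  next
    case (step p r)
    from step.prems(1) show ?case
    proof (cases rule: converse_rtranclpE)
      case base
      then show ?thesis using step.hyps(1) step.prems(3) by (metis stuck_def)
    next
      case (step r')
      then show ?thesis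
        using step.hyps \<open>follow A B p r\<close> follow_unique[OF assms(1,2)] step.IH step.prems by metis
    qed
  qed
qed

text \<open>Edges are undirected, so a run can be retraced once the player to move is flipped at
  both ends.\<close>

lemma follow_reverse:
  assumes "(follow A B)\<^sup>*\<^sup>* (u, b) (v, c)"
  shows "(follow A B)\<^sup>*\<^sup>* (v, \<not> c) (u, \<not> b)"
  using assms
proof (induction rule: rtranclp_induct2)
  case (step v c w d)
  then have "follow A B (w, \<not> d) (v, \<not> c)" by (auto simp: follow_def insert_commute)
  then show ?case using step.IH by (rule converse_rtranclp_into_rtranclp)
qed auto

text \<open>Turns the parity of the path length into the player who cannot move at its end. The last
  conclusion holds because a path without repetitions that ends at the tap has no edges.\<close>

lemma gh_output_halts:
  assumes P: "gh_valid n P" "length x = n" "length y = n"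
  obtains v where "halts_at (alice P x) (bob P y) (tap P, True) (v, \<not> gh_output P x y)"
    "v \<in> insert (tap P) (pipes P)" "v = tap P \<Longrightarrow> \<not> gh_output P x y"
proof -
  let ?A = "alice P x" and ?B = "bob P y"
  have A: "matching (insert (tap P) (pipes P)) ?A" and B: "matching (pipes P) ?B"
    and t: "tap P \<notin> pipes P"
    using P by (auto simp: gh_valid_def)
  define p where "p = gh_path P x y"
  have p: "path_from (tap P) (?A \<union> ?B) p" and max: "\<nexists>v. path_from (tap P) (?A \<union> ?B) (p @ [v])"
    using gh_path_max[OF P] by (auto simp: p_def max_path_from_def)
  have dist: "distinct p" and "p \<noteq> []" and p0: "p ! 0 = tap P"
    using p by (auto simp: path_from_def hd_conv_nth)
  define L where "L = length p - 1"
  have L: "length p = Suc L" using \<open>p \<noteq> []\<close> by (simp add: L_def)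
  have inj: "p ! i = p ! j \<longleftrightarrow> i = j" if "i \<le> L" "j \<le> L" for i j
    using that dist L by (simp add: nth_eq_iff_index_eq)
  have B_t: "{tap P, v} \<notin> ?B" "{v, tap P} \<notin> ?B" for v
    using B t by (auto simp: matching_def)
  \<comment> \<open>The edges alternate: the first is Alice's since Bob does not touch the tap, and
    two consecutive edges of one matching would lead back to the previous vertex.\<close>
  have edge: "{p ! i, p ! Suc i} \<in> (if even i then ?A else ?B)" if "i < L" for i
    using that
  proof (induction i)
    case 0
    then show ?case using path_from_nth[OF p, of 0] L B_t p0 by auto
  next
    case (Suc i)
    have e: "{p ! Suc i, p ! Suc (Suc i)} \<in> ?A \<union> ?B"
      using path_from_nth[OF p, of "Suc i"] L Suc.prems by simp
    have "{p ! Suc i, p ! i} \<in> (if even i then ?A else ?B)"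
      using Suc by (simp add: insert_commute)
    moreover have "p ! i \<noteq> p ! Suc (Suc i)" using inj Suc.prems by simp
    ultimately show ?case
      using e matching_unique[OF A] matching_unique[OF B] by (auto split: if_splits)
  qed
  have reach: "(follow ?A ?B)\<^sup>*\<^sup>* (tap P, True) (p ! i, even i)" if "i \<le> L" for i
    using that
  proof (induction i)
    case 0
    then show ?case using p0 by simp
  next
    case (Suc i)
    have "follow ?A ?B (p ! i, even i) (p ! Suc i, even (Suc i))"
      using edge[of i] Suc.prems by (auto simp: follow_def)
    then show ?case using Suc by (meson Suc_leD rtranclp.rtrancl_into_rtrancl)
  qed
  have "stuck ?A ?B (p ! L, even L)"
    unfolding stuck_def
  proof
    assume "\<exists>q. follow ?A ?B (p ! L, even L) q"
    then obtain v where v: "{p ! L, v} \<in> (if even L then ?A else ?B)"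
      by (auto simp: follow_def)
    have "v \<in> set p"
    proof (rule ccontr)
      assume "v \<notin> set p"
      have "{p ! L, v} \<in> ?A \<union> ?B" using v by (auto split: if_splits)
      then have "path_from (tap P) (?A \<union> ?B) (p @ [v])"
        using p \<open>v \<notin> set p\<close> L
        by (auto simp: path_from_def successively_append_iff last_conv_nth)
      then show False using max by blast
    qed
    then obtain j where j: "j \<le> L" "v = p ! j"
      using L by (metis in_set_conv_nth less_Suc_eq_le)
    have "p ! L \<noteq> v"
      using v A B by (auto simp: matching_def split: if_splits)
    then have "j < L" using j by (metis le_neq_implies_less)
    have v': "{p ! j, p ! L} \<in> (if even L then ?A else ?B)" using v j by (simp add: insert_commute)
    show False
    \<comment> \<open>By maximality the extra edge leads back to some \<open>p ! j\<close>, whose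
      edge in this matching is already on the path: to \<open>p ! Suc j\<close> if \<open>j\<close>
      and \<open>L\<close> have equal parity, otherwise to the predecessor of
      \<open>p ! j\<close>.\<close>
    proof (cases "even j \<longleftrightarrow> even L")
      case True
      then have "p ! Suc j = p ! L"
        using v' edge[OF \<open>j < L\<close>] matching_unique[OF A] matching_unique[OF B]
        by (metis (full_types))
      then show False using inj \<open>j < L\<close> True by (metis Suc_leI even_Suc le_refl)
    next
      case False
      show False
      proof (cases j)
        case 0
        then show False using False v' B_t p0 by auto
      next
        case (Suc l)
        have "{p ! j, p ! l} \<in> (if even L then ?A else ?B)"
          using edge[of l] Suc \<open>j < L\<close> False by (simp add: insert_commute)
        then have "p ! l = p ! L"
          using v' matching_unique[OF A] matching_unique[OF B] by (metis (full_types))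
        then show False using inj Suc \<open>j < L\<close> by auto
      qed
    qed
  qed
  moreover have out: "even L \<longleftrightarrow> \<not> gh_output P x y" by (simp add: gh_output_def p_def L_def)
  ultimately have "halts_at ?A ?B (tap P, True) (p ! L, \<not> gh_output P x y)"
    using reach[of L] by (simp add: halts_at_def)
  moreover have "p ! L \<in> insert (tap P) (pipes P)"
  proof (cases L)
    case (Suc l)
    then show ?thesis using edge[of l] A B by (auto simp: matching_def split: if_splits)
  qed (use p0 in auto)
  moreover have "\<not> gh_output P x y" if "p ! L = tap P"
    using that inj[of L 0] p0 out by auto
  ultimately show thesis using that by blast
qed

lemma gh_output_eqI:
  assumes P: "gh_valid n P" "length x = n" "length y = n"
    and "halts_at (alice P x) (bob P y) (tap P, True) (v, b)"
  shows "gh_output P x y = (\<not> b)"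
proof -
  obtain w where "halts_at (alice P x) (bob P y) (tap P, True) (w, \<not> gh_output P x y)"
    using gh_output_halts[OF P] by metis
  moreover have "matching (insert (tap P) (pipes P)) (alice P x)" "matching (pipes P) (bob P y)"
    using P by (auto simp: gh_valid_def)
  ultimately show ?thesis using halts_at_unique assms(4) by fastforce
qed

section \<open>Renaming the vertices of a protocol\<close>

lemma matching_image:
  assumes "matching W M" "inj_on e W"
  shows "matching (e ` W) ((`) e ` M)"
proof -
  have "e ` a \<subseteq> e ` W \<and> card (e ` a) = 2" if "a \<in> M" for a
    using that assms by (metis card_image image_mono inj_on_subset matching_def)
  moreover have "disjnt (e ` a) (e ` b)" if "a \<in> M" "b \<in> M" "e ` a \<noteq> e ` b" for a b
  proof -
    have "a \<noteq> b" using that(3) by blast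
    then have "a \<inter> b = {}" "a \<subseteq> W" "b \<subseteq> W"
      using that(1,2) assms(1) by (auto simp: matching_def pairwise_def disjnt_def)
    then show ?thesis using inj_on_image_Int[OF assms(2)] by (metis disjnt_def image_empty)
  qed
  ultimately show ?thesis by (auto simp: matching_def pairwise_def)
qed

lemma image_edge_iff:
  assumes "matching W M" "inj_on e W" "u \<in> W"
  shows "{e u, w} \<in> (`) e ` M \<longleftrightarrow> (\<exists>v. w = e v \<and> {u, v} \<in> M)"
proof
  assume "{e u, w} \<in> (`) e ` M"
  then obtain a where a: "a \<in> M" "{e u, w} = e ` a" by auto
  then have "a \<subseteq> W" using assms by (auto simp: matching_def)
  obtain v where v: "v \<in> a" "w = e v" using a by (metis imageE insertCI)
  then have "e ` {u, v} = e ` a" using a by simp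
  then have "{u, v} = a" 
    using inj_on_image_eq_iff[OF assms(2), of "{u, v}" a] assms(3) \<open>a \<subseteq> W\<close> v by auto
  then show "\<exists>v. w = e v \<and> {u, v} \<in> M" using a v by auto
next
  assume "\<exists>v. w = e v \<and> {u, v} \<in> M"
  then obtain v where "w = e v" "{u, v} \<in> M" by blast
  then have "e ` {u, v} \<in> (`) e ` M" "e ` {u, v} = {e u, w}" by (blast, simp)
  then show "{e u, w} \<in> (`) e ` M" by metis
qed

text \<open>Allows protocols over any vertex type, with the output read off from the player who gets
  stuck; an injection into the naturals carries matchings and runs over.\<close>

lemma GH_le_card:
  fixes V :: "'v set"
  assumes "finite V" "t \<notin> V"
    and A: "\<And>x. length x = n \<Longrightarrow> matching (insert t V) (A x)"
    and B: "\<And>y. length y = n \<Longrightarrow> matching V (B y)"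
    and out: "\<And>x y. length x = n \<Longrightarrow> length y = n \<Longrightarrow>
      \<exists>v\<in>insert t V. halts_at (A x) (B y) (t, True) (v, \<not> h x y)"
  shows "GH n h \<le> card V"
proof -
  obtain e :: "'v \<Rightarrow> nat" where e: "inj_on e (insert t V)"
    using finite_imp_inj_to_nat_seg[of "insert t V"] assms(1) by auto
  define P where "P = \<lparr>pipes = e ` V, tap = e t, alice = (\<lambda>x. (`) e ` A x), bob = (\<lambda>y. (`) e ` B y)\<rparr>"
  have eV: "inj_on e V" using e by (rule inj_on_subset) auto
  have valid: "gh_valid n P"
    unfolding gh_valid_def P_def
    using assms(1,2) matching_image[OF A e] matching_image[OF B eV] e by (auto simp: inj_on_def)
  have "gh_output P x y = h x y" if l: "length x = n" "length y = n" for x y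
  proof -
    obtain v where v: "v \<in> insert t V" "halts_at (A x) (B y) (t, True) (v, \<not> h x y)"
      using out[OF l] by blast
    have edge: "{e u, w} \<in> (`) e ` (if b then A x else B y) \<longleftrightarrow>
        (\<exists>v. w = e v \<and> {u, v} \<in> (if b then A x else B y))" if "u \<in> insert t V" for u w b
    proof -
      have "matching (insert t V) (B y)"
        using B[OF l(2)] unfolding matching_def by blast
      then show ?thesis
        using image_edge_iff[OF _ e that] A[OF l(1)] by simp
    qed
    have "(follow (alice P x) (bob P y))\<^sup>*\<^sup>* (e t, True) (e w, c)"
      if "(follow (A x) (B y))\<^sup>*\<^sup>* (t, True) (w, c)" for w c
      using that
    proof (induction rule: rtranclp_induct2)
      case (step u b w c)
      have "e ` {u, w} \<in> (`) e ` (if b then A x else B y)"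
        using step.hyps(2) unfolding follow_def by (intro imageI) simp
      then have "follow (alice P x) (bob P y) (e u, b) (e w, c)"
        using step.hyps(2) by (cases b) (simp_all add: follow_def P_def)
      then show ?case using step.IH by (rule rtranclp.rtrancl_into_rtrancl[rotated])
    qed auto
    moreover have "stuck (alice P x) (bob P y) (e v, \<not> h x y)"
    proof -
      have "\<forall>w. {v, w} \<notin> (if \<not> h x y then A x else B y)"
        using v(2) by (auto simp: halts_at_def stuck_def follow_def)
      then have "\<forall>w. {e v, w} \<notin> (`) e ` (if \<not> h x y then A x else B y)"
        using edge[OF v(1), of _ "\<not> h x y"] by blast
      then show ?thesis by (cases "h x y") (simp_all add: stuck_def follow_def P_def)
    qed
    ultimately have "halts_at (alice P x) (bob P y) (tap P, True) (e v, \<not> h x y)"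
      using v(2) by (simp add: halts_at_def P_def)
    from gh_output_eqI[OF valid l this] show ?thesis by simp
  qed
  then have "gh_computes n P h" using valid by (simp add: gh_computes_def)
  moreover have "card (pipes P) = card V" using eV by (simp add: P_def card_image)
  ultimately show ?thesis
    unfolding GH_def by (metis (mono_tags, lifting) Least_le)
qed


section \<open>Garden-hose protocols from permutation programs\<close>

definition mate_edges :: "('v \<Rightarrow> 'v option) \<Rightarrow> 'v set set" where
  "mate_edges \<alpha> = {{u, v} | u v. \<alpha> u = Some v}"

text \<open>A matching as a partial involution without fixed points, which can be defined by
  cases.\<close>

definition pairing :: "'v set \<Rightarrow> ('v \<Rightarrow> 'v option) \<Rightarrow> bool" where
  "pairing W \<alpha> \<longleftrightarrow> (\<forall>u v. \<alpha> u = Some v \<longrightarrow> u \<noteq> v \<and> u \<in> W \<and> \<alpha> v = Some u)"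

definition mate :: "'v set set \<Rightarrow> 'v \<Rightarrow> 'v option" where
  "mate M u = (if \<exists>v. {u, v} \<in> M then Some (THE v. {u, v} \<in> M) else None)"

lemma pairingD:
  assumes "pairing W \<alpha>" "\<alpha> u = Some v"
  shows "u \<noteq> v" "\<alpha> v = Some u" "u \<in> W" "v \<in> W"
  using assms unfolding pairing_def by blast+

lemma edge_mate_edges:
  assumes "pairing W \<alpha>"
  shows "{u, v} \<in> mate_edges \<alpha> \<longleftrightarrow> \<alpha> u = Some v"
proof
  assume "{u, v} \<in> mate_edges \<alpha>"
  then obtain a b where "{u, v} = {a, b}" "\<alpha> a = Some b" by (auto simp: mate_edges_def)
  then show "\<alpha> u = Some v" using pairingD(2)[OF assms] by (metis doubleton_eq_iff)
qed (auto simp: mate_edges_def)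

lemma matching_mate_edges:
  assumes "pairing W \<alpha>"
  shows "matching W (mate_edges \<alpha>)"
proof -
  have "e \<subseteq> W \<and> card e = 2" if e: "e \<in> mate_edges \<alpha>" for e
  proof -
    from e obtain u v where "e = {u, v}" "\<alpha> u = Some v" by (auto simp: mate_edges_def)
    with pairingD[OF assms] show ?thesis by (metis card_2_iff empty_subsetI insert_subset)
  qed
  moreover have "disjnt d e" if "d \<in> mate_edges \<alpha>" "e \<in> mate_edges \<alpha>" "d \<noteq> e" for d e
  proof -
    from that obtain a b a' b' where *: "d = {a, b}" "\<alpha> a = Some b" "e = {a', b'}" "\<alpha> a' = Some b'"
      by (auto simp: mate_edges_def)
    note pairingD(2)[OF assms *(2)] pairingD(2)[OF assms *(4)]
    then show ?thesis using * that(3) by (auto simp: disjnt_def)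
  qed
  ultimately show ?thesis by (auto simp: matching_def pairwise_def)
qed

lemma mate_eq_Some:
  assumes "matching W M"
  shows "mate M u = Some v \<longleftrightarrow> {u, v} \<in> M"
proof -
  have "(THE v. {u, v} \<in> M) = v" if "{u, v} \<in> M" for v
    using that matching_unique[OF assms] by blast
  then show ?thesis by (auto simp: mate_def)
qed

lemma pairing_mate: "matching W M \<Longrightarrow> pairing W (mate M)"
  unfolding pairing_def
  by (auto simp: mate_eq_Some insert_commute) (auto simp: matching_def)

datatype 'q node = Tap | First | Cell nat 'q bool nat | Last 'q

text \<open>For every layer \<open>j\<close> and state \<open>q\<close> there are two copies \<open>Cell j q d\<close> of the protocol
  of the variable queried in layer \<open>j\<close>. The copy with \<open>d = True\<close> is run forwards. Its path ends
  at a vertex without Alice-edge if the variable is 0 and without Bob-edge if it is 1. There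
  an Alice-edge, respectively Bob-edge, leads to the same vertex of the second copy for the successor
  state, which is then run backwards. Taps are left by Bob in both copies, so
  he can connect consecutive layers.\<close>

locale layered_network =
  fixes n :: nat and tp :: "'i \<Rightarrow> nat" and pp :: "'i \<Rightarrow> nat set"
    and am bm :: "'i \<Rightarrow> bool list \<Rightarrow> nat set set"
    and z :: "bool list \<Rightarrow> bool list \<Rightarrow> 'i \<Rightarrow> bool"
    and Q :: "'q set" and ls :: "('i \<times> (bool \<Rightarrow> 'q \<Rightarrow> 'q)) list" and q0 :: 'q and acc :: "'q \<Rightarrow> bool"
  assumes fin: "(i, \<rho>) \<in> set ls \<Longrightarrow> finite (pp i)" "finite Q"
    and tap: "(i, \<rho>) \<in> set ls \<Longrightarrow> tp i \<notin> pp i"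
    and am: "(i, \<rho>) \<in> set ls \<Longrightarrow> length x = n \<Longrightarrow> matching (insert (tp i) (pp i)) (am i x)"
    and bm: "(i, \<rho>) \<in> set ls \<Longrightarrow> length y = n \<Longrightarrow> matching (pp i) (bm i y)"
    and out: "(i, \<rho>) \<in> set ls \<Longrightarrow> length x = n \<Longrightarrow> length y = n \<Longrightarrow>
      \<exists>v\<in>insert (tp i) (pp i). halts_at (am i x) (bm i y) (tp i, True) (v, \<not> z x y i) \<and>
        (v = tp i \<longrightarrow> \<not> z x y i)"
    and perm: "(i, \<rho>) \<in> set ls \<Longrightarrow> bij (\<rho> b)" "(i, \<rho>) \<in> set ls \<Longrightarrow> \<rho> b ` Q = Q"
    and q0: "q0 \<in> Q" and nonempty: "ls \<noteq> []"
begin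

abbreviation "idx j \<equiv> fst (ls ! j)"
abbreviation "perm_at j \<equiv> snd (ls ! j)"
abbreviation "vs j \<equiv> insert (tp (idx j)) (pp (idx j))"

definition alice_mate :: "bool list \<Rightarrow> 'q node \<Rightarrow> 'q node option" where
  "alice_mate x u = (case u of Tap \<Rightarrow> Some First | First \<Rightarrow> Some Tap | Last q \<Rightarrow> None
   | Cell j q d v \<Rightarrow>
      if j < length ls \<and> q \<in> Q \<and> v \<in> vs j then
        (case mate (am (idx j) x) v of Some w \<Rightarrow> Some (Cell j q d w)
         | None \<Rightarrow> Some (if d then Cell j (perm_at j False q) False v
                             else Cell j (inv (perm_at j False) q) True v))
      else None)"

text \<open>\<open>First\<close> is there because Bob may not touch the tap: after one edge of each
  player Alice is to move at the first inner tap, as in the simulated protocol. \<open>Last\<close>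
  sets the parity: in an accepting state Bob is stuck at the final tap, otherwise he moves to
  \<open>Last\<close>, where Alice is stuck.\<close>

definition bob_mate :: "bool list \<Rightarrow> 'q node \<Rightarrow> 'q node option" where
  "bob_mate y u = (case u of Tap \<Rightarrow> None | First \<Rightarrow> Some (Cell 0 q0 True (tp (idx 0)))
   | Last q \<Rightarrow> if q \<in> Q \<and> \<not> acc q then Some (Cell (length ls - 1) q False (tp (idx (length ls - 1)))) else None
   | Cell j q d v \<Rightarrow>
      if j < length ls \<and> q \<in> Q \<and> v \<in> vs j then
        (if v = tp (idx j) then
           (if d then
              if j = 0 then (if q = q0 then Some First else None)
              else Some (Cell (j - 1) q False (tp (idx (j - 1))))
            else
              if Suc j < length ls then Some (Cell (Suc j) q True (tp (idx (Suc j))))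
              else if acc q then None else Some (Last q))
         else
           (case mate (bm (idx j) y) v of Some w \<Rightarrow> Some (Cell j q d w)
            | None \<Rightarrow> Some (if d then Cell j (perm_at j True q) False v
                                else Cell j (inv (perm_at j True) q) True v)))
      else None)"

definition nodes :: "'q node set" where
  "nodes = insert First (Last ` Q \<union> (\<Union>j<length ls. \<Union>q\<in>Q. \<Union>d. Cell j q d ` vs j))"

lemma Tap_nodes: "Tap \<notin> nodes" by (auto simp: nodes_def)

lemma Cell_nodes: "Cell j q d v \<in> nodes \<longleftrightarrow> j < length ls \<and> q \<in> Q \<and> v \<in> vs j"
  by (simp add: nodes_def image_iff) blast

lemma layer: "j < length ls \<Longrightarrow> (idx j, perm_at j) \<in> set ls" by simp

lemma perm_at_simps:
  assumes "j < length ls"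
  shows "perm_at j b (inv (perm_at j b) q) = q" "inv (perm_at j b) (perm_at j b q) = q"
    "perm_at j b q \<in> Q \<longleftrightarrow> q \<in> Q" "inv (perm_at j b) q \<in> Q \<longleftrightarrow> q \<in> Q"
proof -
  have b: "bij (perm_at j b)" and Q: "perm_at j b ` Q = Q" using perm[OF layer[OF assms]] by auto
  show "perm_at j b (inv (perm_at j b) q) = q" "inv (perm_at j b) (perm_at j b q) = q"
    using b by (simp_all add: bij_is_inj bij_is_surj surj_f_inv_f)
  show "perm_at j b q \<in> Q \<longleftrightarrow> q \<in> Q"
    using Q b by (metis bij_is_inj inj_image_mem_iff)
  show "inv (perm_at j b) q \<in> Q \<longleftrightarrow> q \<in> Q"
    using Q b by (metis bij_inv_eq_iff bij_is_inj inj_image_mem_iff)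
qed

text \<open>The crossing edges form a matching because the layer maps are bijections of
  \<open>Q\<close>. This is why the formula has to be evaluated by permutations.\<close>

lemma pairing_alice:
  assumes "length x = n"
  shows "pairing (insert Tap nodes) (alice_mate x)"
  unfolding pairing_def
proof (intro allI impI)
  fix u v assume uv: "alice_mate x u = Some v"
  show "u \<noteq> v \<and> u \<in> insert Tap nodes \<and> alice_mate x v = Some u"
  proof (cases u)
    case (Cell j q d w)
    then have in_range: "j < length ls" "q \<in> Q" "w \<in> vs j"
      using uv by (auto simp: alice_mate_def split: if_splits)
    note p = pairing_mate[OF am[OF layer[OF in_range(1)] assms]]
    show ?thesis
    proof (cases "mate (am (idx j) x) w")
      case None
      then show ?thesis
        using uv Cell in_range perm_at_simps[OF in_range(1)]
        by (cases d) (auto simp: alice_mate_def Cell_nodes)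
    next
      case (Some w')
      then show ?thesis
        using uv Cell in_range pairingD[OF p Some]
        by (auto simp: alice_mate_def Cell_nodes)
    qed
  qed (use uv in \<open>auto simp: alice_mate_def nodes_def\<close>)
qed

lemma pairing_bob:
  assumes "length y = n"
  shows "pairing nodes (bob_mate y)"
  unfolding pairing_def
proof (intro allI impI)
  fix u v assume uv: "bob_mate y u = Some v"
  show "u \<noteq> v \<and> u \<in> nodes \<and> bob_mate y v = Some u"
  proof (cases u)
    case (Cell j q d w)
    then have in_range: "j < length ls" "q \<in> Q" "w \<in> vs j"
      using uv by (auto simp: bob_mate_def split: if_splits)
    note p = pairing_mate[OF bm[OF layer[OF in_range(1)] assms]]
    have t: "tp (idx j) \<notin> pp (idx j)" using tap[OF layer[OF in_range(1)]] .
    \<comment> \<open>Identifies the layer to which \<open>Last\<close> is attached, so that this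
      edge is seen to be symmetric.\<close>
    have "\<not> Suc j < length ls \<Longrightarrow> length ls - Suc 0 = j" using in_range(1) by linarith
    show ?thesis
    proof (cases "w = tp (idx j)")
      case True
      then show ?thesis
        using uv Cell in_range \<open>\<not> Suc j < length ls \<Longrightarrow> length ls - Suc 0 = j\<close>
        by (cases d; cases j) (auto simp: bob_mate_def Cell_nodes split: if_splits)
    next
      case False
      show ?thesis
      proof (cases "mate (bm (idx j) y) w")
        case None
        then show ?thesis
          using uv Cell in_range perm_at_simps[OF in_range(1)] False
          by (cases d) (auto simp: bob_mate_def Cell_nodes)
      next
        case (Some w')
        then show ?thesis
          using uv Cell in_range pairingD[OF p Some] False t
          by (auto simp: bob_mate_def Cell_nodes)
      qed
    qed
  qed (use uv nonempty q0 in \<open>auto simp: bob_mate_def nodes_def split: if_splits\<close>)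
qed

section \<open>The path through the network on fixed inputs\<close>

context
  fixes x y :: "bool list"
  assumes x: "length x = n" and y: "length y = n"
begin

abbreviation "step \<equiv> follow (mate_edges (alice_mate x)) (mate_edges (bob_mate y))"

lemma step_iff: "step (u, b) (v, c) \<longleftrightarrow> c = (\<not> b) \<and> (if b then alice_mate x u else bob_mate y u) = Some v"
  using edge_mate_edges[OF pairing_alice[OF x]] edge_mate_edges[OF pairing_bob[OF y]]
  by (simp add: follow_def)

lemma step_within_copy:
  assumes "j < length ls" "q \<in> Q"
    and "(follow (am (idx j) x) (bm (idx j) y))\<^sup>*\<^sup>* (u, b) (v, c)"
  shows "step\<^sup>*\<^sup>* (Cell j q d u, b) (Cell j q d v, c)"
  using assms(3)
proof (induction rule: rtranclp_induct2)
  case (step v c w c')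
  note A = am[OF layer[OF assms(1)] x] and B = bm[OF layer[OF assms(1)] y]
  have e: "{v, w} \<in> (if c then am (idx j) x else bm (idx j) y)" "c' = (\<not> c)"
    using step.hyps(2) by (auto simp: follow_def)
  have "step (Cell j q d v, c) (Cell j q d w, c')"
  proof (cases c)
    case True
    then have "mate (am (idx j) x) v = Some w" using e mate_eq_Some[OF A] by simp
    then show ?thesis
      using True e assms(1,2) pairingD(3)[OF pairing_mate[OF A]]
      by (auto simp: step_iff alice_mate_def)
  next
    case False
    then have m: "mate (bm (idx j) y) v = Some w" using e mate_eq_Some[OF B] by simp
    then have "v \<in> pp (idx j)" using pairingD(3)[OF pairing_mate[OF B]] by blast
    then show ?thesis
      using m False e assms(1,2) tap[OF layer[OF assms(1)]]
      by (auto simp: step_iff bob_mate_def)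
  qed
  then show ?case using step.IH by (rule rtranclp.rtrancl_into_rtrancl[rotated])
qed auto

lemma layer_path:
  assumes j: "j < length ls" and q: "q \<in> Q"
  shows "step\<^sup>*\<^sup>* (Cell j q True (tp (idx j)), True)
    (Cell j (perm_at j (z x y (idx j)) q) False (tp (idx j)), False)"
proof -
  let ?b = "z x y (idx j)" and ?A = "am (idx j) x" and ?B = "bm (idx j) y"
  let ?q = "perm_at j ?b q"
  note A = am[OF layer[OF j] x] and B = bm[OF layer[OF j] y]
  obtain v where v: "v \<in> vs j" "halts_at ?A ?B (tp (idx j), True) (v, \<not> ?b)" "v = tp (idx j) \<longrightarrow> \<not> ?b"
    using out[OF layer[OF j] x y] by blast
  then have reach: "(follow ?A ?B)\<^sup>*\<^sup>* (tp (idx j), True) (v, \<not> ?b)"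
    and stuck: "{v, w} \<notin> (if ?b then ?B else ?A)" for w
    by (auto simp: halts_at_def stuck_def follow_def)
  have Q: "?q \<in> Q" using perm_at_simps(3)[OF j] q by blast
  have "step\<^sup>*\<^sup>* (Cell j q True (tp (idx j)), True) (Cell j q True v, \<not> ?b)"
    by (rule step_within_copy[OF j q reach])
  also have "step (Cell j q True v, \<not> ?b) (Cell j ?q False v, ?b)"
  proof (cases ?b)
    case True
    then have "mate ?B v = None" using stuck mate_eq_Some[OF B] by (metis not_None_eq)
    then show ?thesis using True j q v by (simp add: step_iff bob_mate_def)
  next
    case False
    then have "mate ?A v = None" using stuck mate_eq_Some[OF A] by (metis not_None_eq)
    then show ?thesis using False j q v by (simp add: step_iff alice_mate_def)
  qed
  \<comment> \<open>The crossing has flipped the player to move, which is exactly where the reversed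
    run starts.\<close>
  also have "step\<^sup>*\<^sup>* (Cell j ?q False v, ?b) (Cell j ?q False (tp (idx j)), False)"
    using step_within_copy[OF j Q follow_reverse[OF reach]] by simp
  finally show ?thesis .
qed

definition state :: "nat \<Rightarrow> 'q" where
  "state j = fold (\<lambda>(i, \<rho>). \<rho> (z x y i)) (take j ls) q0"

lemma state_Suc: "j < length ls \<Longrightarrow> state (Suc j) = perm_at j (z x y (idx j)) (state j)"
  by (simp add: state_def take_Suc_conv_app_nth case_prod_beta)

lemma state_Q: "j \<le> length ls \<Longrightarrow> state j \<in> Q"
proof (induction j)
  case 0
  then show ?case using q0 by (simp add: state_def)
next
  case (Suc j)
  then show ?case using perm_at_simps(3) by (simp add: state_Suc)
qed

lemma path_to_layer:
  "j < length ls \<Longrightarrow> step\<^sup>*\<^sup>* (Tap, True) (Cell j (state (Suc j)) False (tp (idx j)), False)"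
proof (induction j)
  case 0
  have "step\<^sup>*\<^sup>* (Tap, True) (First, False)"
    by (rule r_into_rtranclp) (simp add: step_iff alice_mate_def)
  also have "step (First, False) (Cell 0 (state 0) True (tp (idx 0)), True)"
    by (simp add: step_iff bob_mate_def state_def)
  also have "step\<^sup>*\<^sup>* (Cell 0 (state 0) True (tp (idx 0)), True) (Cell 0 (state (Suc 0)) False (tp (idx 0)), False)"
    using layer_path[OF 0 state_Q] state_Suc[OF 0] by simp
  finally show ?case by simp
next
  case (Suc j)
  then have "step\<^sup>*\<^sup>* (Tap, True) (Cell j (state (Suc j)) False (tp (idx j)), False)" by simp
  also have "step (Cell j (state (Suc j)) False (tp (idx j)), False)
      (Cell (Suc j) (state (Suc j)) True (tp (idx (Suc j))), True)"
    using Suc.prems state_Q[of "Suc j"] by (simp add: step_iff bob_mate_def)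
  also have "step\<^sup>*\<^sup>* (Cell (Suc j) (state (Suc j)) True (tp (idx (Suc j))), True)
      (Cell (Suc j) (state (Suc (Suc j))) False (tp (idx (Suc j))), False)"
    using layer_path[OF Suc.prems state_Q] state_Suc[OF Suc.prems] Suc.prems by simp
  finally show ?case .
qed

lemma network_output:
  "\<exists>v\<in>insert Tap nodes. halts_at (mate_edges (alice_mate x)) (mate_edges (bob_mate y)) (Tap, True)
    (v, \<not> acc (fold (\<lambda>(i, \<rho>). \<rho> (z x y i)) ls q0))"
proof -
  define j where "j = length ls - 1"
  have j: "j < length ls" "Suc j = length ls" using nonempty by (auto simp: j_def)
  let ?q = "fold (\<lambda>(i, \<rho>). \<rho> (z x y i)) ls q0"
  have s: "state (Suc j) = ?q" by (simp add: state_def j(2))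
  have Q: "?q \<in> Q" using state_Q[of "Suc j"] j s by simp
  have reach: "step\<^sup>*\<^sup>* (Tap, True) (Cell j ?q False (tp (idx j)), False)"
    using path_to_layer[OF j(1)] s by simp
  show ?thesis
  proof (cases "acc ?q")
    case True
    have "bob_mate y (Cell j ?q False (tp (idx j))) = None"
      using True j by (simp add: bob_mate_def)
    then have "halts_at (mate_edges (alice_mate x)) (mate_edges (bob_mate y)) (Tap, True)
        (Cell j ?q False (tp (idx j)), False)"
      using reach by (simp add: halts_at_def stuck_def step_iff)
    then show ?thesis using True Q j by (intro bexI[of _ "Cell j ?q False (tp (idx j))"]) (auto simp: Cell_nodes)
  next
    case False
    have "step (Cell j ?q False (tp (idx j)), False) (Last ?q, True)"
      using False j Q by (simp add: step_iff bob_mate_def)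
    then have "step\<^sup>*\<^sup>* (Tap, True) (Last ?q, True)"
      using reach by (rule rtranclp.rtrancl_into_rtrancl[rotated])
    then have "halts_at (mate_edges (alice_mate x)) (mate_edges (bob_mate y)) (Tap, True) (Last ?q, True)"
      by (simp add: halts_at_def stuck_def step_iff alice_mate_def)
    then show ?thesis using False Q by (intro bexI[of _ "Last ?q"]) (auto simp: nodes_def)
  qed
qed

end

lemma card_nodes:
  assumes "\<forall>(i, \<rho>)\<in>set ls. card (pp i) \<le> c"
  shows "finite nodes" "card nodes \<le> 1 + card Q + 2 * length ls * card Q * (c + 1)"
proof -
  have fin_vs: "finite (vs j)" if "j < length ls" for j
    using fin(1)[OF layer[OF that]] by simp
  then show "finite nodes" unfolding nodes_def using fin(2) by auto
  have cells: "card (\<Union>d. Cell j q d ` vs j) \<le> 2 * (c + 1)" if j: "j < length ls" for j and q :: 'q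
  proof -
    have "card (pp (idx j)) \<le> c" using assms nth_mem[OF j] by (auto simp: case_prod_beta)
    then have "card (Cell j q d ` vs j) \<le> c + 1" for d
      using card_image_le[OF fin_vs[OF j], of "Cell j q d"]
        card_insert_le_m1[of "c + 1" "pp (idx j)" "tp (idx j)"] by simp
    then have "(\<Sum>d\<in>UNIV. card (Cell j q d ` vs j)) \<le> (\<Sum>d\<in>(UNIV::bool set). c + 1)"
      by (intro sum_mono)
    moreover have "card (\<Union>d. Cell j q d ` vs j) \<le> (\<Sum>d\<in>UNIV. card (Cell j q d ` vs j))"
      by (rule card_UN_le) simp
    ultimately show ?thesis by (simp add: UNIV_bool)
  qed
  have "card (\<Union>q\<in>Q. \<Union>d. Cell j q d ` vs j) \<le> card Q * (2 * (c + 1))" if j: "j < length ls" for j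
  proof -
    have "card (\<Union>q\<in>Q. \<Union>d. Cell j q d ` vs j) \<le> (\<Sum>q\<in>Q. card (\<Union>d. Cell j q d ` vs j))"
      by (rule card_UN_le[OF fin(2)])
    also have "\<dots> \<le> (\<Sum>q\<in>Q. 2 * (c + 1))" by (intro sum_mono cells j)
    finally show ?thesis by simp
  qed
  then have "(\<Sum>j<length ls. card (\<Union>q\<in>Q. \<Union>d. Cell j q d ` vs j)) \<le> (\<Sum>j<length ls. card Q * (2 * (c + 1)))"
    by (intro sum_mono) simp
  then have "card (\<Union>j<length ls. \<Union>q\<in>Q. \<Union>d. Cell j q d ` vs j) \<le> length ls * (card Q * (2 * (c + 1)))"
    by (intro order.trans[OF card_UN_le]) auto
  moreover have "card (Last ` Q) \<le> card Q" by (rule card_image_le[OF fin(2)])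
  moreover have "card nodes \<le> Suc (card (Last ` Q \<union> (\<Union>j<length ls. \<Union>q\<in>Q. \<Union>d. Cell j q d ` vs j)))"
    unfolding nodes_def by (rule card_insert_le_m1) auto
  moreover have "card (Last ` Q \<union> (\<Union>j<length ls. \<Union>q\<in>Q. \<Union>d. Cell j q d ` vs j))
      \<le> card (Last ` Q) + card (\<Union>j<length ls. \<Union>q\<in>Q. \<Union>d. Cell j q d ` vs j)"
    by (rule card_Un_le)
  ultimately have "card nodes \<le> 1 + card Q + length ls * (card Q * (2 * (c + 1)))"
    by linarith
  then show "card nodes \<le> 1 + card Q + 2 * length ls * card Q * (c + 1)"
    by (simp only: ac_simps)
qed

lemma GH_network:
  assumes "\<forall>(i, \<rho>)\<in>set ls. card (pp i) \<le> c"
  shows "GH n (\<lambda>x y. acc (fold (\<lambda>(i, \<rho>). \<rho> (z x y i)) ls q0)) \<le> 1 + card Q + 2 * length ls * card Q * (c + 1)"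
proof -
  have "GH n (\<lambda>x y. acc (fold (\<lambda>(i, \<rho>). \<rho> (z x y i)) ls q0)) \<le> card nodes"
    by (rule GH_le_card[OF card_nodes(1)[OF assms] Tap_nodes matching_mate_edges[OF pairing_alice]
          matching_mate_edges[OF pairing_bob] network_output])
  then show ?thesis using card_nodes(2)[OF assms] by linarith
qed

end

section \<open>Layered normal form of permutation programs\<close>

lemma fold_conjugate:
  assumes "bij \<sigma>"
  shows "fold (\<lambda>(i, \<rho>). \<rho> (z i)) (map (\<lambda>(i, \<rho>). (i, \<lambda>b. \<sigma> \<circ> \<rho> b \<circ> inv \<sigma>)) ls) (\<sigma> q) =
    \<sigma> (fold (\<lambda>(i, \<rho>). \<rho> (z i)) ls q)"
  using assms by (induction ls arbitrary: q) (auto simp: bij_is_inj)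

text \<open>All fixed permutations are moved to the start by conjugating the queried layers that
  they pass, so that only queries count as layers.\<close>

lemma perm_prog_layers:
  assumes "perm_prog V Q A a"
  shows "\<exists>ls \<sigma>. length ls \<le> a \<and> bij \<sigma> \<and> \<sigma> ` Q = Q \<and>
    (\<forall>(i, \<rho>)\<in>set ls. i \<in> V \<and> (\<forall>b. bij (\<rho> b) \<and> \<rho> b ` Q = Q)) \<and>
    (\<forall>z q. A z q = fold (\<lambda>(i, \<rho>). \<rho> (z i)) ls (\<sigma> q))"
  using assms
proof (induction rule: perm_prog.induct)
  case (fixed \<sigma> n)
  then show ?case by (intro exI[of _ "[]"] exI[of _ \<sigma>]) auto
next
  case (query i \<sigma>)
  then show ?case
    by (intro exI[of _ "[(i, \<lambda>b. if b then \<sigma> else id)]"] exI[of _ id]) (auto simp: bij_id[unfolded id_def])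
next
  case (comp A a B b)
  from comp.IH(1) obtain la \<sigma> where A: "length la \<le> a" "bij \<sigma>" "\<sigma> ` Q = Q"
    "\<forall>(i, \<rho>)\<in>set la. i \<in> V \<and> (\<forall>b. bij (\<rho> b) \<and> \<rho> b ` Q = Q)"
    "\<forall>z q. A z q = fold (\<lambda>(i, \<rho>). \<rho> (z i)) la (\<sigma> q)" by (elim exE conjE)
  from comp.IH(2) obtain lb \<tau> where B: "length lb \<le> b" "bij \<tau>" "\<tau> ` Q = Q"
    "\<forall>(i, \<rho>)\<in>set lb. i \<in> V \<and> (\<forall>b. bij (\<rho> b) \<and> \<rho> b ` Q = Q)"
    "\<forall>z q. B z q = fold (\<lambda>(i, \<rho>). \<rho> (z i)) lb (\<tau> q)" by (elim exE conjE)
  let ?lb = "map (\<lambda>(i, \<rho>). (i, \<lambda>b. \<sigma> \<circ> \<rho> b \<circ> inv \<sigma>)) lb"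
  have conj: "bij (\<sigma> \<circ> \<rho> \<circ> inv \<sigma>) \<and> (\<sigma> \<circ> \<rho> \<circ> inv \<sigma>) ` Q = Q"
    if "bij \<rho>" "\<rho> ` Q = Q" for \<rho>
  proof
    show "bij (\<sigma> \<circ> \<rho> \<circ> inv \<sigma>)" using that A(2) by (intro bij_comp bij_imp_bij_inv)
    show "(\<sigma> \<circ> \<rho> \<circ> inv \<sigma>) ` Q = Q"
      using that A(3) inv_image_eq[OF A(2,3)] by (simp only: image_comp[symmetric])
  qed
  have "(A z \<circ> B z) q = fold (\<lambda>(i, \<rho>). \<rho> (z i)) (?lb @ la) ((\<sigma> \<circ> \<tau>) q)" for z q
    using A(5) B(5) fold_conjugate[OF A(2), of z lb "\<tau> q"] by simp
  have "\<forall>(i, \<rho>)\<in>set (?lb @ la). i \<in> V \<and> (\<forall>b. bij (\<rho> b) \<and> \<rho> b ` Q = Q)"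
  proof
    fix p assume "p \<in> set (?lb @ la)"
    then consider "p \<in> set la" | i \<rho> where "(i, \<rho>) \<in> set lb" "p = (i, \<lambda>b. \<sigma> \<circ> \<rho> b \<circ> inv \<sigma>)"
      by auto
    then show "case p of (i, \<rho>) \<Rightarrow> i \<in> V \<and> (\<forall>b. bij (\<rho> b) \<and> \<rho> b ` Q = Q)"
    proof cases
      case 1
      then show ?thesis using A(4) by blast
    next
      case 2
      then have "i \<in> V \<and> (\<forall>b. bij (\<rho> b) \<and> \<rho> b ` Q = Q)" using B(4) by blast
      then show ?thesis unfolding 2(2) prod.case using conj by blast
    qed
  qed
  have "(\<sigma> \<circ> \<tau>) ` Q = Q" "bij (\<sigma> \<circ> \<tau>)"
    using A(2,3) B(2,3) by (simp_all only: image_comp[symmetric] bij_comp)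
  have "length (?lb @ la) \<le> a + b" using A(1) B(1) by simp
  show ?case
    by (intro exI[of _ "?lb @ la"] exI[of _ "\<sigma> \<circ> \<tau>"] conjI allI; fact)
qed

lemma GH_perm_prog:
  assumes prog: "perm_prog V Q A a" and "finite Q" "q0 \<in> Q" "i0 \<in> V"
    and P: "\<And>i. i \<in> V \<Longrightarrow> gh_computes n (P i) (f i)" "\<And>i. i \<in> V \<Longrightarrow> card (pipes (P i)) \<le> c"
    and len: "\<And>i x. i \<in> V \<Longrightarrow> length x = N \<Longrightarrow> length (pa i x) = n"
      "\<And>i y. i \<in> V \<Longrightarrow> length y = N \<Longrightarrow> length (pb i y) = n"
  shows "GH N (\<lambda>x y. acc (A (\<lambda>i. f i (pa i x) (pb i y)) q0)) \<le> 1 + card Q + 2 * (a + 1) * card Q * (c + 1)"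
proof -
  from perm_prog_layers[OF prog] obtain ls \<sigma> where ls: "length ls \<le> a" "bij \<sigma>" "\<sigma> ` Q = Q"
    "\<forall>(i, \<rho>)\<in>set ls. i \<in> V \<and> (\<forall>b. bij (\<rho> b) \<and> \<rho> b ` Q = Q)"
    "\<forall>z q. A z q = fold (\<lambda>(i, \<rho>). \<rho> (z i)) ls (\<sigma> q)"
    by (elim exE conjE)
  \<comment> \<open>A dummy query ensures a nonempty list of layers, whence the \<open>a + 1\<close>
    in the bound.\<close>
  let ?ls = "(i0, \<lambda>_. id) # ls"
  have in_ls: "i \<in> V" "bij (\<rho> b)" "\<rho> b ` Q = Q" if "(i, \<rho>) \<in> set ?ls" for i \<rho> b
  proof -
    have "(i, \<rho>) = (i0, \<lambda>_. id) \<or> (i, \<rho>) \<in> set ls" using that by simp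
    then have "i \<in> V \<and> bij (\<rho> b) \<and> \<rho> b ` Q = Q"
    proof
      assume "(i, \<rho>) = (i0, \<lambda>_. id)"
      then show ?thesis using assms(4) by simp
    next
      assume "(i, \<rho>) \<in> set ls"
      then show ?thesis using ls(4) by blast
    qed
    then show "i \<in> V" "bij (\<rho> b)" "\<rho> b ` Q = Q" by blast+
  qed
  have valid: "gh_valid n (P i)" if "i \<in> V" for i using P(1)[OF that] by (simp add: gh_computes_def)
  interpret layered_network N "\<lambda>i. tap (P i)" "\<lambda>i. pipes (P i)" "\<lambda>i x. alice (P i) (pa i x)"
    "\<lambda>i y. bob (P i) (pb i y)" "\<lambda>x y i. f i (pa i x) (pb i y)" Q ?ls "\<sigma> q0" acc
  proof
    fix i \<rho> and x y :: "bool list" assume "(i, \<rho>) \<in> set ?ls" "length x = N" "length y = N"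
    then have l: "length (pa i x) = n" "length (pb i y) = n" and i: "i \<in> V" using in_ls len by blast+
    have "gh_output (P i) (pa i x) (pb i y) = f i (pa i x) (pb i y)"
      using P(1)[OF i] l by (simp add: gh_computes_def)
    moreover obtain v where "halts_at (alice (P i) (pa i x)) (bob (P i) (pb i y)) (tap (P i), True)
        (v, \<not> gh_output (P i) (pa i x) (pb i y))"
      "v \<in> insert (tap (P i)) (pipes (P i))" "v = tap (P i) \<Longrightarrow> \<not> gh_output (P i) (pa i x) (pb i y)"
      using gh_output_halts[OF valid[OF i] l] by blast
    ultimately show "\<exists>v\<in>insert (tap (P i)) (pipes (P i)).
        halts_at (alice (P i) (pa i x)) (bob (P i) (pb i y)) (tap (P i), True) (v, \<not> f i (pa i x) (pb i y)) \<and>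
        (v = tap (P i) \<longrightarrow> \<not> f i (pa i x) (pb i y))"
      by (intro bexI[of _ v]) auto
  next
    show "\<sigma> q0 \<in> Q" using assms(3) ls(3) by blast
  qed (use in_ls valid len assms(2) in \<open>(force simp: gh_valid_def)+\<close>)
  have bound: "\<forall>(i, \<rho>)\<in>set ?ls. card (pipes (P i)) \<le> c" using in_ls(1) P(2) by blast
  have A: "A z q0 = fold (\<lambda>(i, \<rho>). \<rho> (z i)) ?ls (\<sigma> q0)" for z using ls(5) by simp
  have "GH N (\<lambda>x y. acc (A (\<lambda>i. f i (pa i x) (pb i y)) q0)) \<le> 1 + card Q + 2 * length ?ls * card Q * (c + 1)"
    using GH_network[OF bound] by (simp only: A)
  also have "\<dots> \<le> 1 + card Q + 2 * (a + 1) * card Q * (c + 1)"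
    using ls(1) by (intro add_left_mono mult_right_mono) auto
  finally show ?thesis .
qed


section \<open>The composition bound\<close>

lemma eval_cong: "(\<And>i. i \<in> vars F \<Longrightarrow> z i = z' i) \<Longrightarrow> eval z F = eval z' F"
proof (induction F)
  case (Xor Fs)
  then have "filter (eval z) Fs = filter (eval z') Fs" by (intro filter_cong) auto
  then show ?case by simp
qed auto

text \<open>There are neither negations nor empty conjunctions. This settles the case
  \<open>c = 0\<close>, where the bound forces size 0.\<close>

lemma eval_all_False: "fan_in_pos F \<Longrightarrow> (\<And>i. i \<in> vars F \<Longrightarrow> \<not> z i) \<Longrightarrow> \<not> eval z F"
proof (induction F)
  case (And Fs)
  then show ?case by (cases Fs) auto
next
  case (Xor Fs)
  then have "filter (eval z) Fs = []" by (auto simp: filter_empty_conv)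
  then show ?case by simp
qed auto

lemma leaves_pos: "fan_in_pos F \<Longrightarrow> leaves F \<ge> 1"
proof (induction F)
  case (And Fs)
  then show ?case by (cases Fs) (fastforce intro: trans_le_add1)+
next
  case (Or Fs)
  then show ?case by (cases Fs) (fastforce intro: trans_le_add1)+
next
  case (Xor Fs)
  then show ?case by (cases Fs) (fastforce intro: trans_le_add1)+
qed auto

lemma vars_nonempty: "fan_in_pos F \<Longrightarrow> vars F \<noteq> {}"
proof (induction F)
  case (And Fs)
  then show ?case by (cases Fs) auto
next
  case (Or Fs)
  then show ?case by (cases Fs) auto
next
  case (Xor Fs)
  then show ?case by (cases Fs) auto
qed auto

lemma length_nths_card:
  assumes "I \<subseteq> {..<length x}"
  shows "length (nths x I) = card I"
proof -
  have "{i. i < length x \<and> i \<in> I} = I" using assms by auto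
  then show ?thesis by (simp add: length_nths)
qed

lemma GH_const_False:
  assumes "\<And>x y. length x = n \<Longrightarrow> length y = n \<Longrightarrow> \<not> h x y"
  shows "GH n h = 0"
proof -
  have "halts_at {} {} (0::nat, True) (0, True)" by (simp add: halts_at_def stuck_def follow_def)
  then have "GH n h \<le> card ({} :: nat set)"
    using assms by (intro GH_le_card[where t = 0 and A = "\<lambda>_. {}" and B = "\<lambda>_. {}"])
      (auto simp: matching_def)
  then show ?thesis by simp
qed

text \<open>Without pipes the run can only end at the tap, where the output is 0.\<close>

lemma GH_zero:
  assumes "GH n h = 0" "length x = n" "length y = n"
  shows "\<not> h x y"
proof -
  obtain P where P: "gh_computes n P h" "card (pipes P) = 0" using GH_attained assms(1) by metis
  then have valid: "gh_valid n P" by (simp add: gh_computes_def)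
  then have "pipes P = {}" using P(2) by (simp add: gh_valid_def)
  then show ?thesis
    using gh_output_halts[OF valid assms(2,3)] P(1) assms(2,3) by (metis gh_computes_def singletonD)
qed

lemma finite_regs: "finite (regs W)"
proof -
  have "(UNIV :: bit set) = {0, 1}" by (auto simp del: bit_not_one_iff)
  then have "finite (UNIV :: bit set)" by (metis finite.simps)
  then have "finite {r. \<forall>v. (v \<in> {..<W} \<longrightarrow> r v \<in> (UNIV :: bit set)) \<and> (v \<notin> {..<W} \<longrightarrow> r v = 0)}"
    by (intro finite_set_of_finite_funs) auto
  then show ?thesis by (rule rev_finite_subset) (auto simp: regs_def)
qed

text \<open>For the least \<open>j\<close>, the power \<open>B ^ (j - 1)\<close> is still below
  \<open>s\<close> if \<open>j > 0\<close>, so \<open>8 ^ (j - 1) \<le> s powr \<epsilon>\<close>;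
  the last level costs the remaining factor 8.\<close>

lemma log_power_bound:
  fixes \<epsilon> :: real
  assumes "real B powr \<epsilon> \<ge> 8" "B \<ge> 2" "s \<ge> 1" "\<epsilon> > 0"
  obtains j where "s \<le> B ^ j" "8 ^ j \<le> 8 * real s powr \<epsilon>"
proof -
  have "s \<le> B ^ s" using less_exp[of s] power_mono[OF assms(2), of s] by linarith
  then have ex: "\<exists>j. s \<le> B ^ j" by blast
  define j where "j = (LEAST j. s \<le> B ^ j)"
  have j: "s \<le> B ^ j" unfolding j_def using ex by (rule LeastI_ex)
  have "8 ^ j \<le> 8 * real s powr \<epsilon>"
  proof (cases j)
    case 0
    then show ?thesis using ge_one_powr_ge_zero[of "real s" \<epsilon>] assms by simp
  next
    case (Suc i)
    then have "B ^ i < s" using not_less_Least[of i "\<lambda>j. s \<le> B ^ j"] by (simp add: j_def)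
    then have i: "real B ^ i \<le> real s" by (metis less_imp_le of_nat_le_iff of_nat_power)
    have "8 ^ i \<le> (real B powr \<epsilon>) ^ i" using assms(1) by (intro power_mono) auto
    also have "\<dots> = (real B ^ i) powr \<epsilon>" using assms(2) by (simp add: powr_power powr_realpow[symmetric] powr_powr mult.commute)
    also have "\<dots> \<le> real s powr \<epsilon>" using i assms(4) by (intro powr_mono2) auto
    finally show ?thesis by (simp add: Suc)
  qed
  with j show thesis by (rule that)
qed

lemma protocol_size_bound:
  fixes K m c :: nat
  assumes "K \<ge> 1" "m \<ge> 1" "c \<ge> 1"
  shows "1 + K + 2 * (m + 1) * K * (c + 1) \<le> 10 * K * m * c"
proof -
  have "(m + 1) * (c + 1) \<le> (2 * m) * (2 * c)" using assms by (intro mult_le_mono) auto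
  then have "2 * K * ((m + 1) * (c + 1)) \<le> 2 * K * ((2 * m) * (2 * c))" by (rule mult_le_mono2)
  moreover have "2 * K * 1 \<le> 2 * K * (m * c)" using assms by (intro mult_le_mono2) simp
  moreover have "2 * (m + 1) * K * (c + 1) = 2 * K * ((m + 1) * (c + 1))" by (simp only: ac_simps)
  moreover have "10 * K * m * c = 2 * K * ((2 * m) * (2 * c)) + 2 * K * (m * c)" by simp
  ultimately show ?thesis using assms(1) by linarith
qed

lemma GH_formula:
  assumes B: "B > 0" and F: "formula_computes k F g" and s: "leaves F \<le> B ^ j"
    and c: "c \<ge> 1" "\<And>i. i < k \<Longrightarrow> GH n (f i) \<le> c"
    and I: "\<And>i. i < k \<Longrightarrow> I i \<subseteq> {..<N} \<and> card (I i) = n \<and> J i \<subseteq> {..<N} \<and> card (J i) = n"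
  shows "GH N (\<lambda>x y. g (map (\<lambda>i. f i (nths x (I i)) (nths y (J i))) [0..<k]))
    \<le> 10 * card (regs (7 * B + 1)) * (8 ^ j * leaves F) * c"
proof -
  let ?W = "7 * B + 1" and ?m = "8 ^ j * leaves F"
  let ?f = "\<lambda>z. of_bool (eval z F) :: bit"
  have F': "fan_in_pos F" "vars F \<subseteq> {..<k}" "\<And>xs. length xs = k \<Longrightarrow> eval ((!) xs) F = g xs"
    using F by (auto simp: formula_computes_def)
  have "adds {..<k} ?W ?f ?m" using arith_adds[OF B arith_eval[OF F'(2)] s] .
  then have prog: "perm_prog {..<k} (regs ?W) (\<lambda>z. add_to 0 1 (?f z)) ?m"
    using B by (simp add: adds_def)
  obtain i0 where i0: "i0 \<in> {..<k}" using vars_nonempty[OF F'(1)] F'(2) by auto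
  \<comment> \<open>Start state: register 0 holds 1 and register 1 holds 0, so that register 1 ends
    up with the value of the formula.\<close>
  have e0: "unit_vec 0 \<in> regs ?W" by (simp add: regs_def unit_vec_def)
  have "\<exists>P. gh_computes n P (f i) \<and> card (pipes P) \<le> c" if "i < k" for i
    using GH_attained[of n "f i"] c(2)[OF that] by metis
  then obtain P where P: "\<And>i. i < k \<Longrightarrow> gh_computes n (P i) (f i) \<and> card (pipes (P i)) \<le> c" by metis
  have len: "length (nths x (I i)) = n" "length (nths x (J i)) = n" if "i < k" "length x = N" 
    for i and x :: "bool list"
    using I[OF that(1)] that(2) length_nths_card[of "I i" x] length_nths_card[of "J i" x] by auto
  have "GH N (\<lambda>x y. add_to 0 1 (?f (\<lambda>i. f i (nths x (I i)) (nths y (J i)))) (unit_vec 0) 1 = 1)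
      \<le> 1 + card (regs ?W) + 2 * (?m + 1) * card (regs ?W) * (c + 1)"
    by (rule GH_perm_prog[OF prog finite_regs e0 i0, of n P]) (use P len in auto)
  also have "(\<lambda>x y. add_to 0 1 (?f (\<lambda>i. f i (nths x (I i)) (nths y (J i)))) (unit_vec 0) 1 = 1) =
      (\<lambda>x y. g (map (\<lambda>i. f i (nths x (I i)) (nths y (J i))) [0..<k]))"
  proof (intro ext)
    fix x y
    let ?z = "\<lambda>i. f i (nths x (I i)) (nths y (J i))"
    have "eval ((!) (map ?z [0..<k])) F = eval ?z F" using F'(2) by (intro eval_cong) auto
    then have "eval ?z F = g (map ?z [0..<k])" using F'(3)[of "map ?z [0..<k]"] by simp
    then show "(add_to 0 1 (?f ?z) (unit_vec 0) 1 = 1) = g (map ?z [0..<k])"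
      by (simp add: add_to_def unit_vec_def)
  qed
  also have "1 + card (regs ?W) + 2 * (?m + 1) * card (regs ?W) * (c + 1) \<le> 10 * card (regs ?W) * ?m * c"
  proof -
    have K: "card (regs ?W) \<ge> 1" using e0 finite_regs by (metis One_nat_def Suc_leI card_gt_0_iff empty_iff)
    have m: "?m \<ge> 1" using leaves_pos[OF F'(1)] by simp
    show ?thesis by (rule protocol_size_bound[OF K m c(1)])
  qed
  finally show ?thesis .
qed

theorem theorem4:
  fixes \<epsilon> :: real
  assumes "\<epsilon> > 0"
  shows "\<exists>C::real. \<forall>(k::nat) (n::nat) (N::nat) (c::nat) (s::nat) (F::nat formula)
      (g::bool list \<Rightarrow> bool) (f::nat \<Rightarrow> bool list \<Rightarrow> bool list \<Rightarrow> bool)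
      (I::nat \<Rightarrow> nat set) (J::nat \<Rightarrow> nat set).
    formula_computes k F g \<longrightarrow> leaves F = s \<longrightarrow>
    (\<forall>i<k. GH n (f i) \<le> c) \<longrightarrow>
    (\<forall>i<k. I i \<subseteq> {..<N} \<and> card (I i) = n \<and> J i \<subseteq> {..<N} \<and> card (J i) = n) \<longrightarrow>
    real (GH N (\<lambda>x y. g (map (\<lambda>i. f i (nths x (I i)) (nths y (J i))) [0..<k])))
      \<le> C * real s powr (1 + \<epsilon>) * real c"
proof -
  \<comment> \<open>The ceiling gives \<open>B powr \<epsilon> \<ge> 8\<close>; the summand 2 gives
    \<open>B \<ge> 2\<close>.\<close>
  define B where "B = nat \<lceil>8 powr (1 / \<epsilon>)\<rceil> + 2"
  have "8 powr (1 / \<epsilon>) \<le> real B" unfolding B_def by linarith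
  then have "(8 powr (1 / \<epsilon>)) powr \<epsilon> \<le> real B powr \<epsilon>" using assms by (intro powr_mono2) auto
  then have B: "real B powr \<epsilon> \<ge> 8" "B \<ge> 2" using assms by (simp_all add: powr_powr B_def)
  define K where "K = card (regs (7 * B + 1))"
  show ?thesis
  \<comment> \<open>The factor 10 comes from \<open>protocol_size_bound\<close> and 8 from
    \<open>log_power_bound\<close>; \<open>K\<close> depends only on \<epsilon>, through
    \<open>B\<close>.\<close>
  proof (intro exI[of _ "80 * real K"] allI impI)
    fix k n N c s :: nat and F :: "nat formula" and g :: "bool list \<Rightarrow> bool"
      and f :: "nat \<Rightarrow> bool list \<Rightarrow> bool list \<Rightarrow> bool" and I J :: "nat \<Rightarrow> nat set"
    assume F: "formula_computes k F g" and s: "leaves F = s" and c: "\<forall>i<k. GH n (f i) \<le> c"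
      and I: "\<forall>i<k. I i \<subseteq> {..<N} \<and> card (I i) = n \<and> J i \<subseteq> {..<N} \<and> card (J i) = n"
    have F': "fan_in_pos F" "vars F \<subseteq> {..<k}" "\<And>xs. length xs = k \<Longrightarrow> eval ((!) xs) F = g xs"
      using F by (auto simp: formula_computes_def)
    let ?h = "\<lambda>x y. g (map (\<lambda>i. f i (nths x (I i)) (nths y (J i))) [0..<k])"
    show "real (GH N ?h) \<le> 80 * real K * real s powr (1 + \<epsilon>) * real c"
    proof (cases "c = 0")
      case True
      have "\<not> ?h x y" if "length x = N" "length y = N" for x y
      proof -
        have "\<not> f i (nths x (I i)) (nths y (J i))" if "i < k" for i
          using that c I True \<open>length x = N\<close> \<open>length y = N\<close>
          by (intro GH_zero[of n]) (auto simp: length_nths_card)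
        then have "\<not> eval ((!) (map (\<lambda>i. f i (nths x (I i)) (nths y (J i))) [0..<k])) F"
          using F'(2) by (intro eval_all_False[OF F'(1)]) auto
        then show ?thesis using F'(3) by simp
      qed
      then have "GH N ?h = 0" by (rule GH_const_False)
      then show ?thesis by simp
    next
      case False
      have s1: "s \<ge> 1" using leaves_pos[OF F'(1)] s by simp
      obtain j where j: "s \<le> B ^ j" "8 ^ j \<le> 8 * real s powr \<epsilon>"
        using log_power_bound[OF B s1 assms] .
      have "GH N ?h \<le> 10 * K * (8 ^ j * s) * c"
        unfolding K_def s[symmetric]
        by (rule GH_formula[OF _ F]) (use B j s c I False in auto)
      then have "real (GH N ?h) \<le> real (10 * K * (8 ^ j * s) * c)" by (rule of_nat_mono)
      also have "\<dots> = 10 * real K * (8 ^ j * real s) * real c" by simp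
      also have "\<dots> \<le> 10 * real K * ((8 * real s powr \<epsilon>) * real s) * real c"
        using j(2) by (intro mult_right_mono mult_left_mono) auto
      also have "\<dots> = 80 * real K * real s powr (1 + \<epsilon>) * real c"
        using s1 by (simp add: powr_add)
      finally show ?thesis .
    qed
  qed
qed

end
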